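(* Given integers $N,s\ge 1$ with $N\gg s^4$, let $p\ge 3$ be a prime number between $9s^2\lceil\ln^2(N)\rceil$ and $18s^2\lceil\ln^2(N)\rceil$ and let $m=6p^2-6p+1\asymp s^4\ln^2(N)$. Then the matrix $A\in\mathbb{C}^{m\times N}$, with rows indexed by $j\in\{0,\dots,m-1\}$ and columns indexed by an arbitrary $N$-element set $\mathcal{F}$ of polynomials $f$ over $\mathbb{F}_p$ of degree at most $d=\lceil\ln(N/p)/\ln(p)\rceil$, and with entries $$A_{j,f}=\frac{1}{\sqrt{p}}\sum_{k=0}^{p-1}\exp\left(i2\pi\left(j\,\frac{2pk+(k^2)_p}{m}+\frac{k f(k)}{p}\right)\right),\qquad j\in\{0,\dots,m-1\},\ f\in\mathcal{F},$$ provides an explicit embedding from $\ell_2^N(\mathbb{C})$ into $\ell_1^m(\mathbb{C})$ with distortion on $s$-sparse vectors at most $2$, namely $$\frac{m}{\sqrt{3}}\|x\|_2\le\|Ax\|_1\le\frac{2m}{\sqrt{3}}\|x\|_2\qquad\text{for all $s$-sparse }x\in\mathbb{C}^N.$$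
   Context: A vector $x\in\mathbb{C}^N$ (here with coordinates indexed by $\mathcal{F}$) is called $s$-sparse if it has at most $s$ nonzero entries. $\mathbb{F}_p$ is the field with $p$ elements. For an integer $k$, $(k^2)_p$ denotes the integer $t\in\{0,\dots,p-1\}$ such that $k^2\equiv t\pmod p$. In $\exp(i2\pi\,kf(k)/p)$, the element $kf(k)\in\mathbb{F}_p$ is identified with any integer representative (the exponential does not depend on the choice). $\|\cdot\|_1$ and $\|\cdot\|_2$ are the usual (unnormalized) norms. The distortion on $s$-sparse vectors of a map satisfying $\alpha\|x\|_2\le\|Ax\|_1\le\beta\|x\|_2$ for all $s$-sparse $x$ is $\beta/\alpha$.
   Formalization: The size claim m ≍ s^4 ln^2(N) is false, since p ≍ s^2 ln^2(N) forces m = 6p^2-6p+1 ≍ s^4 ln^4(N) (take s = 1, N → ∞); the formal theorem states m ≍ s^4 ln^4(N) with absolute constants instead. *)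

theory Defs
  imports
    Complex_Main
    "HOL-Analysis.L2_Norm"
    "HOL-Algebra.Polynomials"
    "HOL-Number_Theory.Residues"
begin

text \<open>
  Polynomials over \<open>\<int>/p\<close> of degree at most \<open>d\<close>. They are the coefficient lists of
  \<^theory>\<open>HOL-Algebra.Polynomials\<close> (leading coefficient first, no leading zero), so distinct
  lists are distinct polynomials. The zero polynomial \<open>[]\<close> has degree \<open>0\<close> by convention, hence
  it belongs to this set for every \<open>d \<ge> 0\<close>.
\<close>

definition Fp_polys :: "nat \<Rightarrow> int \<Rightarrow> int list set" where
  "Fp_polys p d =
     {f \<in> carrier (univ_poly (residue_ring (int p)) (carrier (residue_ring (int p)))).
        int (Polynomials.degree f) \<le> d}"

text \<open>The value \<open>f(k)\<close> as its representative in \<open>{0..p-1}\<close>; meant for \<open>k \<in> {0..p-1}\<close>.\<close>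

definition Fp_eval :: "nat \<Rightarrow> int list \<Rightarrow> nat \<Rightarrow> int" where
  "Fp_eval p f k = ring.eval (residue_ring (int p)) f (int k)"

definition emb_matrix :: "nat \<Rightarrow> nat \<Rightarrow> nat \<Rightarrow> int list \<Rightarrow> complex" where
  "emb_matrix p m j f =
     1 / complex_of_real (sqrt (real p)) *
     (\<Sum>k = 0..p - 1. exp (\<i> * complex_of_real (2 * pi *
        (real j * (real (2 * p * k + k\<^sup>2 mod p) / real m)
         + real_of_int (int k * Fp_eval p f k) / real p))))"

text \<open>
  Vectors indexed by a finite set \<open>F\<close> are functions of which only the values on \<open>F\<close> matter;
  the rows of a matrix are indexed by \<open>{..<m}\<close>.
\<close>

definition sparse_on :: "'a set \<Rightarrow> nat \<Rightarrow> ('a \<Rightarrow> complex) \<Rightarrow> bool" where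
  "sparse_on F s x \<longleftrightarrow> card {f \<in> F. x f \<noteq> 0} \<le> s"

definition l2_norm_on :: "'a set \<Rightarrow> ('a \<Rightarrow> complex) \<Rightarrow> real" where
  "l2_norm_on F x = L2_set (\<lambda>f. norm (x f)) F"

definition l1_norm_on :: "'a set \<Rightarrow> ('a \<Rightarrow> complex) \<Rightarrow> real" where
  "l1_norm_on J y = (\<Sum>j\<in>J. norm (y j))"

definition mat_apply :: "'a set \<Rightarrow> (nat \<Rightarrow> 'a \<Rightarrow> complex) \<Rightarrow> ('a \<Rightarrow> complex) \<Rightarrow> nat \<Rightarrow> complex" where
  "mat_apply F A x j = (\<Sum>f\<in>F. A j f * x f)"

definition distortion_at_most ::
  "nat \<Rightarrow> 'a set \<Rightarrow> (nat \<Rightarrow> 'a \<Rightarrow> complex) \<Rightarrow> nat \<Rightarrow> real \<Rightarrow> bool" where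
  "distortion_at_most m F A s D \<longleftrightarrow>
     (\<exists>\<alpha> \<beta>. 0 < \<alpha> \<and> \<beta> / \<alpha> \<le> D \<and>
        (\<forall>x. sparse_on F s x \<longrightarrow>
           \<alpha> * l2_norm_on F x \<le> l1_norm_on {..<m} (mat_apply F A x) \<and>
           l1_norm_on {..<m} (mat_apply F A x) \<le> \<beta> * l2_norm_on F x))"

end

theory Submission
  imports
    "HOL-Algebra.Algebraic_Closure_Type"
    "Berlekamp_Zassenhaus.Finite_Field"
    Defs
begin

hide_const (open) Polynomials.degree Polynomials.lead_coeff Coset.order Divisibility.prime
  up_ring.coeff up_ring.monom

text \<open>
  Put \<open>c k = \<Sum> x f e(k f(k)/p)\<close> and \<open>S = \<Sum> |c k|\<^sup>2\<close>. The frequencies \<open>2 p k + (k\<^sup>2 mod p)\<close> form a Sidon set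
  modulo \<open>m\<close>, so the second and fourth moments of \<open>|A x|\<close> are \<open>m S / p\<close> and at most \<open>2 m S\<^sup>2 / p\<^sup>2\<close>;
  Cauchy-Schwarz and Hoelder then give \<open>m sqrt(S/2p) \<le> \<parallel>A x\<parallel>\<^sub>1 \<le> m sqrt(S/p)\<close>. Weil's bound for additive
  character sums makes the Gram matrix of the vectors \<open>e(k f(k)/p)\<close> diagonally dominant on sparse vectors,
  which gives \<open>\<bar>S - p \<parallel>x\<parallel>\<^sub>2\<^sup>2\<bar> \<le> p \<parallel>x\<parallel>\<^sub>2\<^sup>2 / 3\<close>.

  Weil's bound is proved by Stepanov's method. The \<open>L\<close>-function of the sum is a polynomial of degree less
  than \<open>deg h\<close>, and its logarithmic derivative generates the sums over all extension fields. A polynomial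
  of low degree that vanishes to high order where the trace of \<open>h\<close> takes a given value bounds these sums
  by a constant times \<open>p\<^sup>(i/2)\<close>, so that all zeros of the \<open>L\<close>-function have modulus at least \<open>p\<^sup>(-1/2)\<close>.
\<close>

section \<open>The L-function of an additive character sum\<close>

text \<open>Stepanov's polynomial gives a bound whose constant depends on \<open>p\<close> and on
  the degree of \<open>h\<close>, so it says nothing at \<open>i = 1\<close>, the only case that is
  wanted. But only the growth rate in \<open>i\<close> matters: a constant factor does not move the
  radius of convergence of the series of power sums. This is why all extension fields enter. They
  are fixed point sets of Frobenius powers inside one algebraically closed field; polynomials over
  the prime field are those that coefficientwise Frobenius fixes, and Frobenius orbits of roots
  replace irreducible factors. No field needs a type of its own.

  The distortion \<open>2\<close> splits evenly. The moments lose a factor \<open>sqrt 2\<close>,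
  since \<open>S / 2\<close> faces \<open>S\<close> in the two bounds; the Gram estimate loses
  another, since \<open>S\<close> lies between 2/3 and 4/3 of \<open>p\<close> times the squared
  norm. The factor \<open>9\<close> in the lower bound for \<open>p\<close> is what makes the
  deviation one third: inner products are at most \<open>d sqrt p\<close>, \<open>d\<close> is at
  most \<open>ln N\<close>, and so \<open>3 d s\<close> is at most \<open>sqrt p\<close>.\<close>

lemma coeff_mult_top:
  fixes A B :: "'b::comm_semiring_0 poly"
  assumes "degree A \<le> a" "degree B \<le> b"
  shows "coeff (A * B) (a + b) = coeff A a * coeff B b"
proof -
  have "coeff A i * coeff B (a + b - i) = 0" if "i \<le> a + b" "i \<noteq> a" for i
  proof (cases "i < a")
    case True
    then have "coeff B (a + b - i) = 0" using assms by (intro coeff_eq_0) linarith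
    then show ?thesis by simp
  next
    case False
    then have "coeff A i = 0" using assms that by (intro coeff_eq_0) linarith
    then show ?thesis by simp
  qed
  then have "(\<Sum>i\<le>a+b. coeff A i * coeff B (a + b - i)) = (\<Sum>i\<in>{a}. coeff A i * coeff B (a + b - i))"
    by (intro sum.mono_neutral_right) auto
  then show ?thesis by (simp add: coeff_mult)
qed

lemma size_proots_alg_closed:
  fixes f :: "'a::alg_closed_field poly"
  assumes "f \<noteq> 0"
  shows "size (proots f) = degree f"
proof -
  obtain A where A: "size A = degree f" "f = smult (lead_coeff f) (\<Prod>x\<in>#A. [:-x, 1:])"
    using alg_closed_imp_factorization[OF assms] by blast
  have "proots (\<Prod>x\<in>#A. [:-x, 1:]) = A"
  proof (induction A)
    case (add x A)
    have "(\<Prod>x\<in>#A. [:-x, 1:]) \<noteq> 0" by (auto simp: prod_mset_zero_iff)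
    then have "proots ([:- x, 1:] * (\<Prod>x\<in>#A. [:-x, 1:])) = proots [:- x, 1:] + A"
      using add by (subst proots_mult) auto
    then show ?case by (simp del: mult_pCons_left)
  qed auto
  then have "proots f = A"
    using A(2) assms by (metis leading_coeff_0_iff proots_smult)
  then show ?thesis using A(1) by simp
qed

lemma sum_order_roots:
  fixes f :: "'a::alg_closed_field poly"
  assumes "f \<noteq> 0"
  shows "(\<Sum>a | poly f a = 0. order a f) = degree f"
proof -
  have "size (proots f) = (\<Sum>a\<in>set_mset (proots f). count (proots f) a)"
    by (simp add: size_multiset_overloaded_eq)
  then show ?thesis using assms by (simp add: size_proots_alg_closed)
qed

lemma prod_linear_power_dvd:
  fixes g :: "'b::field poly"
  assumes "finite A" "g \<noteq> 0" "\<And>x. x \<in> A \<Longrightarrow> [:- x, 1:] ^ j dvd g"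
  shows "(\<Prod>x\<in>A. [:- x, 1:] ^ j) dvd g"
  using assms
proof (induction A rule: finite_induct)
  case (insert x A)
  then obtain k where k: "g = (\<Prod>x\<in>A. [:- x, 1:] ^ j) * k" by (auto elim: dvdE)
  have "poly (\<Prod>x\<in>A. [:- x, 1:] ^ j) x \<noteq> 0"
    using insert by (auto simp: poly_prod)
  then have "order x (\<Prod>x\<in>A. [:- x, 1:] ^ j) = 0" by (simp add: order_0I)
  then have "order x g = order x k"
    using order_mult[of "\<Prod>x\<in>A. [:- x, 1:] ^ j" k x] insert.prems(1) k by simp
  moreover have "j \<le> order x g" using insert.prems by (simp add: order_divides)
  ultimately have "[:- x, 1:] ^ j dvd k" by (simp add: order_divides)
  then have "[:- x, 1:] ^ j * (\<Prod>x\<in>A. [:- x, 1:] ^ j) dvd k * (\<Prod>x\<in>A. [:- x, 1:] ^ j)"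
    by (intro mult_dvd_mono) auto
  then show ?case using insert k by (simp add: mult.commute)
qed auto

lemma prod_lessThan_add:
  fixes f :: "nat \<Rightarrow> 'b::comm_monoid_mult"
  shows "(\<Prod>l<m + e. f l) = (\<Prod>l<m. f l) * (\<Prod>l<e. f (m + l))"
  by (induction e) (simp_all add: mult.assoc)

section \<open>Finite subfields of an algebraically closed field of characteristic
  \<open>p\<close>\<close>

locale prime_char_closure =
  fixes p :: nat and K :: "'a::alg_closed_field itself"
  assumes CHAR_eq: "CHAR('a) = p" and prime_p: "prime p"
begin

lemma p_pos: "p > 0" and p_gt1: "p > 1"
  using prime_p prime_gt_0_nat prime_gt_1_nat by auto

lemma frob_add: "(x + y :: 'a) ^ p ^ i = x ^ p ^ i + y ^ p ^ i"
  by (rule freshmans_dream') (use CHAR_eq prime_p in auto)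

lemma frob_sum: "(\<Sum>x\<in>A. (f x :: 'a)) ^ p ^ i = (\<Sum>x\<in>A. f x ^ p ^ i)"
  by (rule freshmans_dream_sum') (use CHAR_eq prime_p in auto)

lemma frob_minus: "(- x :: 'a) ^ p ^ i = - (x ^ p ^ i)"
proof -
  have "(- x) ^ p ^ i + x ^ p ^ i = (- x + x) ^ p ^ i" by (simp only: frob_add)
  also have "\<dots> = 0" using p_pos by (simp add: power_0_left)
  finally show ?thesis by (simp add: eq_neg_iff_add_eq_0)
qed

lemma frob_diff: "(x - y :: 'a) ^ p ^ i = x ^ p ^ i - y ^ p ^ i"
  using frob_add[of x "- y" i] by (simp add: frob_minus)

lemma frob_inj: "(x :: 'a) ^ p ^ i = y ^ p ^ i \<longleftrightarrow> x = y"
proof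
  assume "x ^ p ^ i = y ^ p ^ i"
  then have "(x - y) ^ p ^ i = 0" by (simp add: frob_diff)
  then show "x = y" by simp
qed auto

lemmas frob_add_1 = frob_add[where i = 1, simplified]
lemmas frob_sum_1 = frob_sum[where i = 1, simplified]
lemmas frob_minus_1 = frob_minus[where i = 1, simplified]

lemma frob_poly_add: "(f + g :: 'a poly) ^ p ^ i = f ^ p ^ i + g ^ p ^ i"
  by (rule freshmans_dream') (use CHAR_eq prime_p in auto)

text \<open>The field with \<open>p ^ i\<close> elements. At \<open>i = 0\<close> the condition is
  empty and this is the whole type, hence the assumption \<open>i > 0\<close> wherever finiteness
  matters.\<close>

definition GF :: "nat \<Rightarrow> 'a set" where "GF i = {x. x ^ p ^ i = x}"

lemma GF_add: "x \<in> GF i \<Longrightarrow> y \<in> GF i \<Longrightarrow> x + y \<in> GF i"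
  and GF_diff: "x \<in> GF i \<Longrightarrow> y \<in> GF i \<Longrightarrow> x - y \<in> GF i"
  and GF_mult: "x \<in> GF i \<Longrightarrow> y \<in> GF i \<Longrightarrow> x * y \<in> GF i"
  and GF_uminus: "x \<in> GF i \<Longrightarrow> - x \<in> GF i"
  and GF_divide: "x \<in> GF i \<Longrightarrow> y \<in> GF i \<Longrightarrow> x / y \<in> GF i"
  by (simp_all add: GF_def frob_add frob_diff frob_minus power_mult_distrib power_divide)

lemma GF_0: "0 \<in> GF i" and GF_1: "1 \<in> GF i"
  using p_pos by (simp_all add: GF_def power_0_left)

lemma GF_of_nat: "of_nat k \<in> GF i"
  by (induction k) (auto intro: GF_0 GF_add GF_1)

lemma GF_poly: "GF i = {x. poly (monom 1 (p ^ i) - monom 1 1) x = 0}"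
  by (auto simp: GF_def poly_monom)

text \<open>\<open>X ^ q - X\<close> has derivative \<open>- 1\<close>, so its roots are simple, and
  over an algebraically closed field there are as many as its degree.\<close>

lemma card_GF:
  assumes "i > 0" shows "card (GF i) = p ^ i"
proof -
  define f :: "'a poly" where "f = monom 1 (p ^ i) - monom 1 1"
  have q: "p ^ i > 1" using p_gt1 assms by (rule one_less_power)
  have "coeff f (p ^ i) = 1" unfolding f_def using q by (simp add: coeff_monom)
  then have f0: "f \<noteq> 0" by auto
  have "degree (monom (1::'a) (p ^ i) + (- monom 1 1)) = degree (monom (1::'a) (p ^ i))"
    by (rule degree_add_eq_left) (use q in \<open>simp add: degree_monom_eq\<close>)
  then have deg: "degree f = p ^ i" unfolding f_def by (simp add: degree_monom_eq)
  have "(of_nat (p ^ i) :: 'a) = 0" using CHAR_eq assms by (simp add: of_nat_eq_0_iff_char_dvd)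
  then have pd: "pderiv f = - 1"
    unfolding f_def by (simp add: pderiv_diff pderiv_monom monom_0 one_pCons del: of_nat_power)
  have ord: "order a f = 1" if "poly f a = 0" for a
  proof -
    have "order a f \<noteq> 0" using that f0 order_root by blast
    moreover have "\<not> 2 \<le> order a f"
    proof
      assume "2 \<le> order a f"
      then have "[:- a, 1:] ^ 2 dvd f" using f0 order_divides by blast
      then obtain k where "f = [:- a, 1:] ^ 2 * k" by (rule dvdE)
      then have "f = [:- a, 1:] * ([:- a, 1:] * k)" by (simp add: power2_eq_square mult.assoc del: mult_pCons_left)
      then have "poly (pderiv f) a = 0" by (simp add: pderiv_mult del: mult_pCons_left)
      then show False by (simp add: pd)
    qed
    ultimately show ?thesis by linarith
  qed
  have "card (GF i) = (\<Sum>a | poly f a = 0. order a f)"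
    using ord unfolding GF_poly f_def by simp
  then show ?thesis using sum_order_roots[OF f0] deg by simp
qed

lemma finite_GF: "i > 0 \<Longrightarrow> finite (GF i)"
  using card_GF[of i] p_pos by (metis card.infinite not_gr_zero power_eq_0_iff)

lemma inj_on_of_nat: "inj_on (of_nat :: nat \<Rightarrow> 'a) {..<p}"
proof (rule inj_onI)
  have *: "x = y" if "x \<le> y" "y < p" "of_nat x = (of_nat y :: 'a)" for x y
  proof -
    have "(of_nat (y - x) :: 'a) = 0" using that by (simp add: of_nat_diff)
    then have "p dvd y - x" by (simp add: of_nat_eq_0_iff_char_dvd CHAR_eq)
    then show ?thesis using that by (metis diff_is_0_eq dvd_imp_le le_antisym less_imp_diff_less not_gr_zero not_less)
  qed
  fix x y assume "x \<in> {..<p}" "y \<in> {..<p}" "of_nat x = (of_nat y :: 'a)"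
  then show "x = y" using *[of x y] *[of y x] by (metis lessThan_iff nat_le_linear)
qed

lemma GF_1_eq: "GF 1 = of_nat ` {..<p}"
proof (rule sym, rule card_subset_eq)
  show "finite (GF 1)" by (simp add: finite_GF)
  show "of_nat ` {..<p} \<subseteq> GF 1" using GF_of_nat by auto
  show "card (of_nat ` {..<p} :: 'a set) = card (GF 1)"
    using card_GF[of 1] card_image[OF inj_on_of_nat] by simp
qed

text \<open>Frobenius acts on the coefficients only, so \<open>Fr f = f\<close> encodes that they
  lie in the prime field.\<close>

definition Fr :: "'a poly \<Rightarrow> 'a poly" where "Fr = map_poly (\<lambda>x. x ^ p)"

lemma coeff_Fr: "coeff (Fr f) k = coeff f k ^ p"
  unfolding Fr_def using p_pos by (simp add: coeff_map_poly power_0_left)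

lemma Fr_mult: "Fr (f * g) = Fr f * Fr g"
  by (intro poly_eqI) (simp add: coeff_Fr coeff_mult power_mult_distrib frob_sum_1)

lemma Fr_add: "Fr (f + g) = Fr f + Fr g"
  by (intro poly_eqI) (simp add: coeff_Fr frob_add_1)

lemma Fr_1: "Fr 1 = 1"
  using p_pos by (intro poly_eqI) (auto simp: coeff_Fr power_0_left coeff_1)

lemma Fr_power: "Fr (f ^ k) = Fr f ^ k"
  by (induction k) (auto simp: Fr_mult Fr_1)

lemma Fr_prod: "Fr (prod f A) = (\<Prod>x\<in>A. Fr (f x))"
  by (induction A rule: infinite_finite_induct) (auto simp: Fr_mult Fr_1)

lemma Fr_linear: "Fr [:- a, 1:] = [:- (a ^ p), 1:]"
  using p_pos
  by (intro poly_eqI) (auto simp: frob_minus_1 coeff_Fr coeff_pCons power_0_left split: nat.splits)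

lemma Fr_monom: "Fr (monom c k) = monom (c ^ p) k"
  using p_pos by (intro poly_eqI) (auto simp: coeff_Fr power_0_left)

lemma degree_Fr: "degree (Fr f) = degree f"
  by (rule antisym; rule degree_le) (use p_pos in \<open>auto simp: coeff_Fr coeff_eq_0 power_0_left\<close>,
     metis coeff_Fr coeff_eq_0 power_eq_0_iff)

lemma Fr_dvd: "f dvd g \<Longrightarrow> Fr f dvd Fr g"
  by (auto simp: dvd_def Fr_mult)

lemma Fr_pderiv: "Fr (pderiv f) = pderiv (Fr f)"
  using GF_of_nat[of _ 1]
  by (intro poly_eqI) (simp add: coeff_Fr coeff_pderiv power_mult_distrib GF_def del: of_nat_Suc)

lemma poly_Fr: "poly (Fr f) (x ^ p) = poly f x ^ p"
  by (simp add: poly_altdef degree_Fr coeff_Fr power_mult_distrib frob_sum_1 mult.commute flip: power_mult)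

lemma Fr_fixed_poly:
  assumes "Fr f = f" shows "poly f (x ^ p ^ l) = poly f x ^ p ^ l"
proof (induction l)
  case (Suc l)
  then show ?case using poly_Fr[of f "x ^ p ^ l"] assms by (simp add: power_mult[symmetric] mult.commute)
qed auto

section \<open>Monic polynomials over the prime field and Frobenius orbits\<close>

definition monics :: "nat \<Rightarrow> 'a poly set" where
  "monics r = {g. degree g = r \<and> lead_coeff g = 1 \<and> Fr g = g}"

lemma finite_monics: "finite (monics r)"
proof (rule finite_subset)
  show "monics r \<subseteq> Poly ` {xs. set xs \<subseteq> GF 1 \<and> length xs = Suc r}"
  proof
    fix g assume "g \<in> monics r"
    then have g: "degree g = r" "Fr g = g" "lead_coeff g = 1" by (auto simp: monics_def)
    then have "g \<noteq> 0" by auto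
    then have "set (coeffs g) \<subseteq> GF 1" "length (coeffs g) = Suc r"
      using g coeff_Fr[of g] by (auto simp: coeffs_def GF_def)
    then show "g \<in> Poly ` {xs. set xs \<subseteq> GF 1 \<and> length xs = Suc r}"
      by (intro image_eqI[of _ _ "coeffs g"]) auto
  qed
  show "finite (Poly ` {xs. set xs \<subseteq> GF 1 \<and> length xs = Suc r})"
    by (intro finite_imageI finite_lists_length_eq finite_GF) auto
qed

lemma monics_0: "monics 0 = {1}"
proof -
  have "g = 1" if "degree g = 0" "lead_coeff g = 1" for g :: "'a poly"
    using that by (elim degree_eq_zeroE) (auto simp: one_pCons)
  then show ?thesis by (auto simp: monics_def Fr_1)
qed

lemma monics_mult: "f \<in> monics r \<Longrightarrow> g \<in> monics s \<Longrightarrow> f * g \<in> monics (r + s)"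
  by (auto simp: monics_def Fr_mult lead_coeff_mult degree_mult_eq)
     (subst degree_mult_eq; auto)

lemma monics_divide:
  assumes "f * g \<in> monics r" "f \<in> monics i" shows "g \<in> monics (r - i)"
proof -
  have nz: "f \<noteq> 0" "g \<noteq> 0" using assms by (auto simp: monics_def)
  have "f * Fr g = f * g" using assms by (simp add: monics_def Fr_mult)
  then have "Fr g = g" using nz by simp
  moreover have "lead_coeff g = 1" using assms by (auto simp: monics_def lead_coeff_mult)
  moreover have "degree g = r - i" using assms nz by (auto simp: monics_def degree_mult_eq)
  ultimately show ?thesis by (simp add: monics_def)
qed

text \<open>For \<open>a\<close> in \<open>GF i\<close> this is the characteristic polynomial of
  \<open>a\<close> over the prime field: the minimal polynomial raised to \<open>i\<close> divided
  by the degree of \<open>a\<close>.\<close>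

definition orbit_poly :: "nat \<Rightarrow> 'a \<Rightarrow> 'a poly" where
  "orbit_poly i a = (\<Prod>l<i. [:- (a ^ p ^ l), 1:])"

lemma orbit_poly_nz: "orbit_poly i a \<noteq> 0"
  by (simp add: orbit_poly_def)

text \<open>Frobenius shifts the conjugates by one place, and \<open>a ^ p ^ i = a\<close> closes
  the cycle.\<close>

lemma orbit_poly_monics:
  assumes "a \<in> GF i" shows "orbit_poly i a \<in> monics i"
proof -
  have "Fr (orbit_poly i a) = (\<Prod>l<i. [:- (a ^ p ^ Suc l), 1:])"
    by (simp add: orbit_poly_def Fr_prod Fr_linear mult.commute flip: power_mult)
  also have "\<dots> = orbit_poly i a"
  proof (cases i)
    case (Suc j)
    have "(\<Prod>l<i. [:- (a ^ p ^ Suc l), 1:]) = (\<Prod>l<j. [:- (a ^ p ^ Suc l), 1:]) * [:- (a ^ p ^ i), 1:]"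
      using Suc by simp
    also have "\<dots> = [:- (a ^ p ^ 0), 1:] * (\<Prod>l<j. [:- (a ^ p ^ Suc l), 1:])"
      using assms by (simp add: GF_def mult.commute del: mult_pCons_left mult_pCons_right)
    also have "\<dots> = orbit_poly i a"
      unfolding orbit_poly_def Suc by (subst prod.lessThan_Suc_shift) simp
    finally show ?thesis .
  qed (simp add: orbit_poly_def)
  finally have "Fr (orbit_poly i a) = orbit_poly i a" .
  moreover have "degree (orbit_poly i a) = i"
    unfolding orbit_poly_def by (subst degree_prod_eq_sum_degree) auto
  moreover have "lead_coeff (orbit_poly i a) = 1"
    unfolding orbit_poly_def by (subst lead_coeff_prod) auto
  ultimately show ?thesis by (simp add: monics_def)
qed

lemma root_frob:
  assumes "Fr g = g" "poly g a = 0" shows "poly g (a ^ p ^ l) = 0"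
  using Fr_fixed_poly[OF assms(1), of a l] assms(2) p_pos by (simp add: power_0_left)

lemma root_power_dvd_frob:
  assumes "Fr g = g" "[:- a, 1:] ^ j dvd g" shows "[:- (a ^ p ^ l), 1:] ^ j dvd g"
proof (induction l)
  case (Suc l)
  then have "Fr ([:- (a ^ p ^ l), 1:] ^ j) dvd Fr g" by (rule Fr_dvd)
  then show ?case using assms(1) by (simp add: Fr_power Fr_linear mult.commute flip: power_mult)
qed (use assms in simp)

lemma orbit_poly_iterate:
  assumes "a \<in> GF e" shows "orbit_poly (e * j) a = orbit_poly e a ^ j"
proof (induction j)
  case (Suc j)
  have aej: "a ^ p ^ (e * j) = a"
  proof (induction j)
    case (Suc j)
    then show ?case using assms by (simp add: GF_def power_add power_mult[symmetric] mult.commute)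
       (simp add: power_mult)
  qed simp
  have "orbit_poly (e * Suc j) a = (\<Prod>l<e * j + e. [:- (a ^ p ^ l), 1:])"
    by (simp add: orbit_poly_def add.commute)
  also have "\<dots> = orbit_poly (e * j) a * (\<Prod>l<e. [:- (a ^ p ^ (e * j + l)), 1:])"
    unfolding orbit_poly_def by (rule prod_lessThan_add)
  also have "(\<Prod>l<e. [:- (a ^ p ^ (e * j + l)), 1:]) = orbit_poly e a"
    unfolding orbit_poly_def by (intro prod.cong refl) (simp only: power_add power_mult aej[unfolded power_mult])
  finally show ?case using Suc by simp
qed (simp add: orbit_poly_def)

text \<open>The orbit of \<open>a\<close> lies among the finitely many roots of \<open>g\<close>,
  and Frobenius is injective, so the orbit is a pure cycle; its length \<open>e\<close> is the
  degree of \<open>a\<close> over the prime field.\<close>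

lemma period:
  assumes "Fr g = g" "g \<noteq> 0" "poly g a = 0"
  obtains e where "e > 0" "a \<in> GF e" "\<And>i. a \<in> GF i \<longleftrightarrow> e dvd i"
    "inj_on (\<lambda>l. a ^ p ^ l) {..<e}"
proof -
  have GF_diff_index: "a \<in> GF (j - i)" if "i \<le> j" "a ^ p ^ i = a ^ p ^ j" for i j
  proof -
    have "(a ^ p ^ (j - i)) ^ p ^ i = a ^ p ^ i"
      using that by (simp flip: power_mult power_add)
    then show ?thesis by (simp add: frob_inj GF_def)
  qed
  have "finite (range (\<lambda>l. a ^ p ^ l))"
    using root_frob[OF assms(1,3)] by (intro finite_subset[OF _ poly_roots_finite[OF assms(2)]]) auto
  then have "\<not> inj (\<lambda>l. a ^ p ^ l)" using finite_imageD by fastforce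
  then obtain i j where "i < j" "a ^ p ^ i = a ^ p ^ j"
    unfolding inj_on_def by (metis nat_neq_iff)
  then have ex: "\<exists>e>0. a \<in> GF e" using GF_diff_index[of i j] by (intro exI[of _ "j - i"]) auto
  define e where "e = (LEAST e. e > 0 \<and> a \<in> GF e)"
  have e: "e > 0" "a \<in> GF e" using LeastI_ex[OF ex] unfolding e_def by auto
  have least: "e \<le> i" if "i > 0" "a \<in> GF i" for i
    unfolding e_def using that by (intro Least_le) auto
  have mult: "a \<in> GF (e * k)" for k
  proof (induction k)
    case (Suc k)
    have "a ^ p ^ (e + e * k) = (a ^ p ^ e) ^ p ^ (e * k)" by (simp add: power_add power_mult)
    then show ?case using Suc e by (simp add: GF_def)
  qed (simp add: GF_def)
  have "e dvd i" if "a \<in> GF i" for i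
  proof (rule ccontr)
    assume n: "\<not> e dvd i"
    have "a ^ p ^ (e * (i div e)) = a ^ p ^ i" using mult[of "i div e"] that by (simp add: GF_def)
    then have "a \<in> GF (i - e * (i div e))" by (intro GF_diff_index) auto
    then have "a \<in> GF (i mod e)" by (simp add: minus_mult_div_eq_mod)
    moreover have "i mod e > 0" using n by (simp add: dvd_eq_mod_eq_0)
    ultimately have "e \<le> i mod e" using least by blast
    then show False using e(1) by (meson leD mod_less_divisor)
  qed
  moreover have "a \<in> GF i" if "e dvd i" for i using that mult by (auto simp: dvd_def)
  moreover have "inj_on (\<lambda>l. a ^ p ^ l) {..<e}"
  proof -
    have False if "i < j" "j < e" "a ^ p ^ i = a ^ p ^ j" for i j
      using GF_diff_index[of i j] least[of "j - i"] that by auto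
    then show ?thesis by (intro linorder_inj_onI) auto
  qed
  ultimately show thesis using e that by blast
qed

text \<open>Coefficientwise Frobenius fixes \<open>g\<close>, so the \<open>e\<close> distinct
  conjugates of \<open>a\<close> are roots of \<open>g\<close> of the same multiplicity.\<close>

lemma orbit_poly_power_dvd_iff:
  assumes "Fr g = g" "g \<noteq> 0" "e > 0" "inj_on (\<lambda>l. a ^ p ^ l) {..<e}"
  shows "orbit_poly e a ^ j dvd g \<longleftrightarrow> j \<le> order a g"
proof
  assume "orbit_poly e a ^ j dvd g"
  moreover have "[:- a, 1:] dvd orbit_poly e a"
    unfolding orbit_poly_def using assms(3) dvd_prodI[of "{..<e}" 0 "\<lambda>l. [:- (a ^ p ^ l), 1:]"] by simp
  ultimately have "[:- a, 1:] ^ j dvd g" by (meson dvd_power_same dvd_trans)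
  then show "j \<le> order a g" using assms(2) by (simp add: order_divides)
next
  assume "j \<le> order a g"
  then have "[:- a, 1:] ^ j dvd g" using assms(2) by (simp add: order_divides)
  then have d: "[:- (a ^ p ^ l), 1:] ^ j dvd g" for l by (rule root_power_dvd_frob[OF assms(1)])
  define A where "A = (\<lambda>l. a ^ p ^ l) ` {..<e}"
  have "(\<Prod>x\<in>A. [:- x, 1:] ^ j) dvd g"
    using d assms(2) by (intro prod_linear_power_dvd) (auto simp: A_def)
  also have "(\<Prod>x\<in>A. [:- x, 1:] ^ j) = orbit_poly e a ^ j"
    unfolding A_def orbit_poly_def using assms(4) by (simp add: prod.reindex prod_power_distrib)
  finally show "orbit_poly e a ^ j dvd g" .
qed

text \<open>This count stands in for factorisation into irreducibles. A root \<open>a\<close> of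
  degree \<open>e\<close> and multiplicity \<open>j\<close> is counted exactly at
  \<open>i = e, 2 e, ..., j e\<close>, thus \<open>j\<close> times, and the multiplicities add up to
  \<open>r\<close>.\<close>

lemma sum_orbit_poly_dvd:
  assumes "g \<in> monics r"
  shows "(\<Sum>i=1..r. card {a \<in> GF i. orbit_poly i a dvd g}) = r"
proof -
  have g: "Fr g = g" "degree g = r" "g \<noteq> 0" using assms by (auto simp: monics_def)
  define Z where "Z = {a. poly g a = 0}"
  have fZ: "finite Z" unfolding Z_def using g poly_roots_finite by blast
  have inZ: "a \<in> Z" if "orbit_poly i a dvd g" "i > 0" for i a
  proof -
    have "poly (orbit_poly i a) a = 0"
      unfolding orbit_poly_def poly_prod using that(2) by (auto intro!: bexI[of _ 0])
    then show ?thesis using that(1) by (auto simp: Z_def dvd_def)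
  qed
  \<comment> \<open>Keeps every multiple \<open>e * j\<close> counted below within the range
    \<open>1..r\<close>.\<close>
  have deg: "i \<le> r" if "orbit_poly i a dvd g" "a \<in> GF i" for i a
    using dvd_imp_degree_le[OF that(1) g(3)] orbit_poly_monics[OF that(2)] g(2) by (simp add: monics_def)
  have cnt: "card {i \<in> {1..r}. a \<in> GF i \<and> orbit_poly i a dvd g} = order a g" if "a \<in> Z" for a
  proof -
    have "poly g a = 0" using that by (simp add: Z_def)
    then obtain e where e: "e > 0" "a \<in> GF e" "\<And>i. a \<in> GF i \<longleftrightarrow> e dvd i"
      "inj_on (\<lambda>l. a ^ p ^ l) {..<e}"
      by (rule period[OF g(1,3)]) blast
    have dv: "orbit_poly (e * j) a dvd g \<longleftrightarrow> j \<le> order a g" for j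
      by (simp add: orbit_poly_iterate e(2) orbit_poly_power_dvd_iff[OF g(1,3) e(1,4)])
    have "{i \<in> {1..r}. a \<in> GF i \<and> orbit_poly i a dvd g} = (\<lambda>j. e * j) ` {1..order a g}"
    proof (intro Set.set_eqI iffI)
      fix i assume i: "i \<in> {i \<in> {1..r}. a \<in> GF i \<and> orbit_poly i a dvd g}"
      then obtain j where "i = e * j" using e(3) by (auto elim: dvdE)
      then show "i \<in> (\<lambda>j. e * j) ` {1..order a g}" using i dv by (auto intro!: imageI)
    next
      fix i assume "i \<in> (\<lambda>j. e * j) ` {1..order a g}"
      then obtain j where j: "i = e * j" "1 \<le> j" "j \<le> order a g"
        unfolding image_iff Bex_def atLeastAtMost_iff by blast
      then have "orbit_poly i a dvd g" "a \<in> GF i" using dv e(3) by auto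
      then show "i \<in> {i \<in> {1..r}. a \<in> GF i \<and> orbit_poly i a dvd g}"
        using deg j e(1) by auto
    qed
    also have "card \<dots> = card {1..order a g}"
      using e(1) by (intro card_image) (auto simp: inj_on_def)
    finally show ?thesis by simp
  qed
  have "(\<Sum>i=1..r. card {a \<in> GF i. orbit_poly i a dvd g})
      = (\<Sum>i=1..r. \<Sum>a\<in>Z. if a \<in> GF i \<and> orbit_poly i a dvd g then 1 else 0)"
  proof (intro sum.cong refl)
    fix i assume "i \<in> {1..r}"
    then have "{a \<in> GF i. orbit_poly i a dvd g} = {a \<in> Z. a \<in> GF i \<and> orbit_poly i a dvd g}"
      using inZ by auto
    then show "card {a \<in> GF i. orbit_poly i a dvd g} = (\<Sum>a\<in>Z. if a \<in> GF i \<and> orbit_poly i a dvd g then 1 else 0)"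
      using fZ by (simp add: sum.If_cases Int_def)
  qed
  also have "\<dots> = (\<Sum>a\<in>Z. \<Sum>i=1..r. if a \<in> GF i \<and> orbit_poly i a dvd g then 1 else 0)"
    by (rule sum.swap)
  also have "\<dots> = (\<Sum>a\<in>Z. order a g)"
    using cnt by (intro sum.cong) (auto simp: sum.If_cases Int_def)
  also have "\<dots> = r" using sum_order_roots[OF g(3)] g(2) by (simp add: Z_def)
  finally show ?thesis .
qed

end

section \<open>The trace of \<open>h\<close> over the roots as a residue\<close>

text \<open>
  The sum of \<open>h\<close> over the roots of \<open>g\<close>, as the residue of \<open>h g'/g\<close> at infinity: in this form it is
  visibly in the prime field and easy to follow when a coefficient of \<open>g\<close> changes.
\<close>
definition residue_trace :: "'b::field poly \<Rightarrow> 'b poly \<Rightarrow> 'b" where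
  "residue_trace h g = coeff ((h * pderiv g) mod g) (degree g - 1)"

lemma mod_poly_eqI:
  fixes f :: "'b::field poly"
  assumes "f = q * g + r" "degree r < degree g"
  shows "f mod g = r"
  using assms by (simp add: poly_mod_add_left mod_poly_less)

lemma degree_mod_less_of_pos:
  fixes g :: "'b::field poly"
  assumes "degree g > 0" shows "degree (f mod g) < degree g"
  using degree_mod_less[of g f] assms by force

text \<open>Logarithmic derivatives add. Over the common denominator the remainders combine to
  \<open>R f * g + R g * f\<close>, still of degree below that of \<open>f * g\<close>, and for
  monic factors its top coefficient is the sum of theirs.\<close>

lemma residue_trace_mult:
  fixes h :: "'b::field poly"
  assumes f: "lead_coeff f = 1" and g: "lead_coeff g = 1"
  shows "residue_trace h (f * g) = residue_trace h f + residue_trace h g"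
\<comment> \<open>Degree zero is separate because \<open>degree f - 1\<close> is a truncated
  subtraction there; the monic factor is then \<open>1\<close>.\<close>
proof (cases "degree f = 0 \<or> degree g = 0")
  case True
  moreover have "u = 1" if "degree u = 0" "lead_coeff u = 1" for u :: "'b poly"
    using that by (elim degree_eq_zeroE) (auto simp: one_pCons)
  ultimately have "f = 1 \<or> g = 1" using f g by blast
  then show ?thesis by (auto simp: residue_trace_def)
next
  case False
  define R where "R u = (h * pderiv u) mod u" for u
  define Q where "Q u = (h * pderiv u) div u" for u
  have QR: "h * pderiv u = Q u * u + R u" for u unfolding Q_def R_def by simp
  have nz: "f \<noteq> 0" "g \<noteq> 0" using f g by auto
  have dR: "degree (R f) < degree f" "degree (R g) < degree g"
    unfolding R_def using False by (auto intro: degree_mod_less_of_pos)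
  have deg: "degree (f * g) = degree f + degree g" using nz by (simp add: degree_mult_eq)
  have "h * pderiv (f * g) = h * pderiv f * g + h * pderiv g * f"
    by (simp add: pderiv_mult algebra_simps)
  also have "\<dots> = (Q f + Q g) * (f * g) + (R f * g + R g * f)"
    unfolding QR by (simp add: algebra_simps)
  finally have eq: "h * pderiv (f * g) = (Q f + Q g) * (f * g) + (R f * g + R g * f)" .
  have "degree (R f * g + R g * f) < degree (f * g)"
    using dR deg degree_mult_le[of "R f" g] degree_mult_le[of "R g" f]
    by (intro degree_add_less) linarith+
  then have m: "(h * pderiv (f * g)) mod (f * g) = R f * g + R g * f"
    by (rule mod_poly_eqI[OF eq])
  have "coeff (R f * g) ((degree f - 1) + degree g) = coeff (R f) (degree f - 1) * coeff g (degree g)"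
    using dR by (intro coeff_mult_top) auto
  moreover have "coeff (R g * f) ((degree g - 1) + degree f) = coeff (R g) (degree g - 1) * coeff f (degree f)"
    using dR by (intro coeff_mult_top) auto
  moreover have "(degree f - 1) + degree g = degree (f * g) - 1" "(degree g - 1) + degree f = degree (f * g) - 1"
    using False deg by auto
  ultimately show ?thesis
    unfolding residue_trace_def m using f g by (simp add: R_def)
qed

lemma residue_trace_linear: "residue_trace h [:- a, 1:] = poly h a"
proof -
  have "h = synthetic_div h a * [:- a, 1:] + [:poly h a:]"
    using synthetic_div_correct'[of a h] by (simp only: mult.commute)
  then have "h mod [:- a, 1:] = [:poly h a:]" by (rule mod_poly_eqI) simp
  then show ?thesis by (simp add: residue_trace_def pderiv_pCons)
qed

lemma residue_trace_1: "residue_trace h 1 = 0"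
  by (simp add: residue_trace_def)

lemma residue_trace_prod_linear:
  "finite A \<Longrightarrow> residue_trace h (\<Prod>l\<in>A. [:- f l, 1:]) = (\<Sum>l\<in>A. poly h (f l))"
proof (induction A rule: finite_induct)
  case (insert x A)
  have "lead_coeff (\<Prod>l\<in>A. [:- f l, 1:]) = 1"
    by (subst lead_coeff_prod) auto
  then have "residue_trace h ([:- f x, 1:] * (\<Prod>l\<in>A. [:- f l, 1:]))
    = residue_trace h [:- f x, 1:] + residue_trace h (\<Prod>l\<in>A. [:- f l, 1:])"
    by (intro residue_trace_mult) auto
  then show ?case using insert by (simp add: residue_trace_linear del: mult_pCons_left)
qed (simp add: residue_trace_1)

lemma degree_pderiv_le: "degree (pderiv f) \<le> degree f - 1"
  for f :: "'b::field poly"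
  by (rule degree_le) (auto simp: coeff_pderiv coeff_eq_0)

text \<open>This shift is what makes the sum over all monic polynomials of degree \<open>r \<ge> n\<close> vanish.\<close>
lemma residue_trace_perturb:
  fixes h g :: "'b::field poly"
  assumes g: "lead_coeff g = 1" "degree g = r" and n: "degree h = n" "0 < n" "n \<le> r"
  shows "residue_trace h (g + monom t (r - n)) = residue_trace h g - of_nat n * lead_coeff h * t"
proof -
  define G where "G = g + monom t (r - n)"
  have dm: "degree (monom t (r - n)) < r" using degree_monom_le[of t "r - n"] n by linarith
  have dG: "degree G = r" unfolding G_def using dm g by (simp add: degree_add_eq_left)
  have lG: "coeff G r = 1" unfolding G_def using g n by simp
  have lg: "coeff g r = 1" using g by simp
  define R where "R u = (h * pderiv u) mod u" for u
  define Q where "Q u = (h * pderiv u) div u" for u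
  have QR: "h * pderiv u = Q u * u + R u" for u unfolding Q_def R_def by simp
  have r: "r > 0" using n by simp
  have dR: "degree (R G) \<le> r - 1" "degree (R g) \<le> r - 1"
    unfolding R_def using degree_mod_less_of_pos[of G "h * pderiv G"] degree_mod_less_of_pos[of g "h * pderiv g"] r dG g by auto
  \<comment> \<open>Numerator of \<open>G' / G - g' / g\<close>. The common part \<open>g\<close>
    cancels, so only the added monomial contributes: top terms \<open>(r - n) t\<close> and
    \<open>- r t\<close> combine to \<open>- n t\<close>.\<close>
  define D where "D = pderiv G * g - pderiv g * G"
  have top: "coeff (pderiv g * monom t (r - n)) ((r - 1) + (r - n)) = of_nat r * t"
    using degree_pderiv_le[of g] g lg r degree_monom_le[of t "r - n"]
    by (subst coeff_mult_top) (auto simp: coeff_pderiv)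
  have hD: "h * D = (Q G - Q g) * (G * g) + (R G * g - R g * G)"
  proof -
    have "h * D = (h * pderiv G) * g - (h * pderiv g) * G" by (simp add: D_def algebra_simps)
    then show ?thesis unfolding QR by (simp add: algebra_simps)
  qed
  have dD: "degree D \<le> 2 * r - n - 1 \<and> coeff D (2 * r - n - 1) = - (of_nat n * t)"
  proof (cases "r = n")
    \<comment> \<open>The added monomial is constant here and its derivative vanishes; the exponent
      \<open>r - n - 1\<close> of the other case would be truncated.\<close>
    case True
    then have D: "D = - (pderiv g * monom t 0)"
      by (simp add: D_def G_def pderiv_add pderiv_monom algebra_simps)
    have "degree (pderiv g * monom t 0) \<le> r - 1"
      using degree_mult_le[of "pderiv g" "monom t 0"] degree_pderiv_le[of g] g degree_monom_le[of t 0] by simp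
    then show ?thesis using top True unfolding D by simp
  next
    case False
    then have D: "D = monom (of_nat (r - n) * t) (r - n - 1) * g - pderiv g * monom t (r - n)"
      by (simp add: D_def G_def pderiv_add pderiv_monom algebra_simps)
    have e: "2 * r - n - 1 = (r - n - 1) + r" "2 * r - n - 1 = (r - 1) + (r - n)"
      using False n by auto
    have "coeff (monom (of_nat (r - n) * t) (r - n - 1) * g) ((r - n - 1) + r) = of_nat (r - n) * t"
      using g lg degree_monom_le[of _ "r - n - 1"] by (subst coeff_mult_top) auto
    then have "coeff D (2 * r - n - 1) = of_nat (r - n) * t - of_nat r * t"
      unfolding D using top e by (metis coeff_diff)
    then have "coeff D (2 * r - n - 1) = - (of_nat n * t)"
      using n by (simp add: of_nat_diff algebra_simps)
    moreover have "degree D \<le> 2 * r - n - 1"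
      unfolding D
    proof (rule degree_diff_le)
      show "degree (monom (of_nat (r - n) * t) (r - n - 1) * g) \<le> 2 * r - n - 1"
        using degree_mult_le[of "monom (of_nat (r - n) * t) (r - n - 1)" g] g e
          degree_monom_le[of "of_nat (r - n) * t" "r - n - 1"] by linarith
      show "degree (pderiv g * monom t (r - n)) \<le> 2 * r - n - 1"
        using degree_mult_le[of "pderiv g" "monom t (r - n)"] g e degree_pderiv_le[of g]
          degree_monom_le[of t "r - n"] by linarith
    qed
    ultimately show ?thesis by simp
  qed
  have dRR: "degree (R G * g - R g * G) \<le> (r - 1) + r"
    using degree_mult_le[of "R G" g] degree_mult_le[of "R g" G] dR dG g by (intro degree_diff_le) linarith+
  have dhD: "degree (h * D) \<le> (r - 1) + r"
    using degree_mult_le[of h D] n dD by linarith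
  \<comment> \<open>\<open>h * D\<close> and the remainder part have degree at most
    \<open>2 * r - 1\<close>, whereas a nonzero multiple of \<open>G * g\<close> has degree at least
    \<open>2 * r\<close>.\<close>
  have QQ: "Q G - Q g = 0"
  proof (rule ccontr)
    assume nz: "Q G - Q g \<noteq> 0"
    have "G \<noteq> 0" "g \<noteq> 0" using lG lg by auto
    then have "degree ((Q G - Q g) * (G * g)) \<ge> 2 * r"
      using nz dG g by (simp add: degree_mult_eq)
    moreover have "degree ((Q G - Q g) * (G * g)) \<le> (r - 1) + r"
      using hD dRR dhD by (metis add_diff_cancel_right' degree_diff_le)
    ultimately show False using r by linarith
  qed
  have "coeff (h * D) (n + (2 * r - n - 1)) = lead_coeff h * - (of_nat n * t)"
    using coeff_mult_top[of h n D "2 * r - n - 1"] dD n by simp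
  moreover have "n + (2 * r - n - 1) = (r - 1) + r" using n by linarith
  moreover have "coeff (R G * g) ((r - 1) + r) = coeff (R G) (r - 1)"
    using coeff_mult_top[of "R G" "r - 1" g r] dR g lg by simp
  moreover have "coeff (R g * G) ((r - 1) + r) = coeff (R g) (r - 1)"
    using coeff_mult_top[of "R g" "r - 1" G r] dR dG lG by simp
  ultimately have "coeff (R G) (r - 1) - coeff (R g) (r - 1) = - (lead_coeff h * of_nat n * t)"
    using hD QQ by simp
  then show ?thesis
    unfolding residue_trace_def G_def[symmetric] dG g(2) R_def by (simp add: algebra_simps)
qed

section \<open>The character sum, its \<open>L\<close>-function and the recurrence\<close>

locale additive_sum = prime_char_closure p K
  for p and K :: "'a::alg_closed_field itself" +
  fixes psi :: "'a \<Rightarrow> complex" and h :: "'a poly"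
  assumes psi_add: "x \<in> GF 1 \<Longrightarrow> y \<in> GF 1 \<Longrightarrow> psi (x + y) = psi x * psi y"
    and norm_psi: "x \<in> GF 1 \<Longrightarrow> norm (psi x) = 1"
    and psi_nontrivial: "\<exists>x\<in>GF 1. psi x \<noteq> 1"
    and Fr_h: "Fr h = h"
    and degree_h: "0 < degree h" "degree h < p"
begin

lemma psi_0: "psi 0 = 1"
proof -
  have "psi 0 * psi 0 = psi 0" using psi_add[of 0 0] by (simp add: GF_0)
  moreover have "psi 0 \<noteq> 0" using norm_psi[of 0] by (auto simp: GF_0)
  ultimately show ?thesis by simp
qed

definition lambda :: "'a poly \<Rightarrow> complex" where "lambda g = psi (residue_trace h g)"

text \<open>Coefficient of \<open>z ^ r\<close> in the \<open>L\<close>-function, the generating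
  function of the multiplicative \<open>lambda\<close> over monic polynomials by degree.\<close>

definition lcoeff :: "nat \<Rightarrow> complex" where "lcoeff r = (\<Sum>g\<in>monics r. lambda g)"

text \<open>The inner sum is the trace of \<open>poly h a\<close> from \<open>GF i\<close> to the
  prime field, so this is the character sum over the extension of degree \<open>i\<close>.\<close>

definition ssum :: "nat \<Rightarrow> complex" where
  "ssum i = (\<Sum>a\<in>GF i. psi (\<Sum>l<i. poly h a ^ p ^ l))"

text \<open>Frobenius maps a division by \<open>g\<close> with remainder to another one; remainders
  are unique, so this one has its coefficients in the prime field.\<close>

lemma residue_trace_GF:
  assumes "Fr g = g" "lead_coeff g = 1"
  shows "residue_trace h g \<in> GF 1"
proof (cases "degree g = 0")
  case True
  then have "g = 1" using assms(2) by (elim degree_eq_zeroE) (auto simp: one_pCons)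
  then show ?thesis by (simp add: residue_trace_1 GF_0)
next
  case False
  define u where "u = h * pderiv g"
  have "Fr u = u" by (simp add: u_def Fr_mult Fr_h Fr_pderiv assms)
  have "u = (u div g) * g + u mod g" by simp
  then have "Fr u = Fr (u div g) * Fr g + Fr (u mod g)" by (metis Fr_add Fr_mult)
  then have "u = Fr (u div g) * g + Fr (u mod g)" using \<open>Fr u = u\<close> assms by simp
  moreover have "degree (Fr (u mod g)) < degree g"
    using False by (simp add: degree_Fr degree_mod_less_of_pos)
  ultimately have "u mod g = Fr (u mod g)" by (rule mod_poly_eqI)
  then show ?thesis
    unfolding residue_trace_def GF_def u_def[symmetric] using coeff_Fr[of "u mod g"] by simp
qed

lemma lambda_mult:
  assumes "f \<in> monics r" "g \<in> monics s" shows "lambda (f * g) = lambda f * lambda g"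
proof -
  have fg: "Fr f = f" "lead_coeff f = 1" "Fr g = g" "lead_coeff g = 1" using assms by (auto simp: monics_def)
  then show ?thesis
    using residue_trace_mult[of f g h] psi_add[OF residue_trace_GF residue_trace_GF, of f g]
    by (simp add: lambda_def)
qed

lemma lambda_orbit_poly:
  "lambda (orbit_poly i a) = psi (\<Sum>l<i. poly h a ^ p ^ l)"
  unfolding lambda_def orbit_poly_def
  by (simp add: residue_trace_prod_linear Fr_fixed_poly[OF Fr_h])

lemma lcoeff_0: "lcoeff 0 = 1"
  by (simp add: lcoeff_def monics_0 lambda_def residue_trace_1 psi_0)

text \<open>Adding \<open>t X ^ (r - n)\<close> permutes \<open>monics r\<close> and multiplies
  every \<open>lambda g\<close> by the same \<open>psi u\<close>, which is not \<open>1\<close>. The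
  trace shifts by \<open>c * t\<close>, and \<open>c\<close> is nonzero because
  \<open>0 < n < p\<close>, so \<open>t = u / c\<close> is available.\<close>

lemma lcoeff_eq_0:
  assumes "degree h \<le> r" shows "lcoeff r = 0"
proof -
  define n where "n = degree h"
  obtain u where u: "u \<in> GF 1" "psi u \<noteq> 1" using psi_nontrivial by blast
  define c where "c = - (of_nat n * lead_coeff h)"
  have lc: "lead_coeff h \<in> GF 1" using coeff_Fr[of h n] Fr_h by (simp add: GF_def n_def)
  have "c \<in> GF 1" unfolding c_def by (intro GF_uminus GF_mult GF_of_nat lc)
  have "(of_nat n :: 'a) \<noteq> 0"
    using degree_h CHAR_eq by (auto simp: of_nat_eq_0_iff_char_dvd n_def dest: dvd_imp_le)
  then have "c \<noteq> 0" unfolding c_def using degree_h(1) by auto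
  define t where "t = u / c"
  have t: "t \<in> GF 1" unfolding t_def by (intro GF_divide u \<open>c \<in> GF 1\<close>)
  define S where "S = (\<lambda>g :: 'a poly. g + monom t (r - n))"
  have n0: "n > 0" "n \<le> r" using degree_h assms by (auto simp: n_def)
  have perturb: "g + monom s (r - n) \<in> monics r" if "g \<in> monics r" "s \<in> GF 1" for g s
  proof -
    have dm: "degree (monom s (r - n)) < r" using degree_monom_le[of s "r - n"] n0 by linarith
    have "degree (g + monom s (r - n)) = r" using that dm by (simp add: monics_def degree_add_eq_left)
    moreover have "coeff (g + monom s (r - n)) r = 1" using that n0 by (auto simp: monics_def)
    moreover have "Fr (g + monom s (r - n)) = g + monom s (r - n)"
      using that by (simp add: Fr_add Fr_monom monics_def GF_def)
    ultimately show ?thesis by (simp add: monics_def)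
  qed
  have step: "lambda (S g) = psi u * lambda g" if "g \<in> monics r" for g
  proof -
    have "residue_trace h (S g) = residue_trace h g + u"
    proof -
      have "lead_coeff g = 1" "degree g = r" using that by (auto simp: monics_def)
      from residue_trace_perturb[OF this n_def[symmetric] n0, of t]
      have "residue_trace h (S g) = residue_trace h g + c * t"
        unfolding S_def c_def by simp
      then show ?thesis using \<open>c \<noteq> 0\<close> by (simp add: t_def)
    qed
    moreover have "residue_trace h g \<in> GF 1" using that residue_trace_GF by (auto simp: monics_def)
    ultimately show ?thesis using u by (simp add: lambda_def psi_add)
  qed
  have "lcoeff r = (\<Sum>g\<in>monics r. lambda (S g))"
    unfolding lcoeff_def
  proof (rule sum.reindex_bij_witness[of _ S "\<lambda>g. g + monom (- t) (r - n)"])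
    show "g + monom (- t) (r - n) \<in> monics r" if "g \<in> monics r" for g
      by (rule perturb) (use that t GF_uminus in auto)
    show "S g \<in> monics r" if "g \<in> monics r" for g
      unfolding S_def by (rule perturb) (use that t in auto)
  qed (auto simp: S_def add.assoc add_monom)
  also have "\<dots> = psi u * lcoeff r" unfolding lcoeff_def by (simp add: step sum_distrib_left)
  finally show ?thesis using u(2) by simp
qed

text \<open>The weight \<open>r\<close> of each \<open>lambda g\<close> is rewritten by
  \<open>sum_orbit_poly_dvd\<close> as a count of divisors \<open>orbit_poly i a\<close>. After
  swapping sums, a multiple of such a divisor is the divisor times a cofactor in
  \<open>monics (r - i)\<close>, and \<open>lambda\<close> is multiplicative.\<close>

lemma lcoeff_recurrence:
  "of_nat r * lcoeff r = (\<Sum>i=1..r. ssum i * lcoeff (r - i))"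
proof -
  have "of_nat r * lcoeff r = (\<Sum>g\<in>monics r. of_nat (\<Sum>i=1..r. card {a \<in> GF i. orbit_poly i a dvd g}) * lambda g)"
    unfolding lcoeff_def sum_distrib_left by (intro sum.cong refl) (simp only: sum_orbit_poly_dvd)
  also have "\<dots> = (\<Sum>g\<in>monics r. \<Sum>i=1..r. \<Sum>a\<in>GF i. if orbit_poly i a dvd g then lambda g else 0)"
  proof (intro sum.cong refl)
    fix g
    have "of_nat (card {a \<in> GF i. orbit_poly i a dvd g}) * lambda g
        = (\<Sum>a\<in>GF i. if orbit_poly i a dvd g then lambda g else 0)" if "i \<in> {1..r}" for i
      using that finite_GF[of i] by (simp add: sum.If_cases Int_def)
    then show "of_nat (\<Sum>i=1..r. card {a \<in> GF i. orbit_poly i a dvd g}) * lambda g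
      = (\<Sum>i=1..r. \<Sum>a\<in>GF i. if orbit_poly i a dvd g then lambda g else 0)"
      by (simp add: sum_distrib_right)
  qed
  also have "\<dots> = (\<Sum>i=1..r. \<Sum>g\<in>monics r. \<Sum>a\<in>GF i. if orbit_poly i a dvd g then lambda g else 0)"
    by (rule sum.swap)
  also have "\<dots> = (\<Sum>i=1..r. \<Sum>a\<in>GF i. \<Sum>g\<in>monics r. if orbit_poly i a dvd g then lambda g else 0)"
    by (intro sum.cong refl sum.swap)
  also have "\<dots> = (\<Sum>i=1..r. \<Sum>a\<in>GF i. lambda (orbit_poly i a) * lcoeff (r - i))"
  proof (intro sum.cong refl)
    fix i a assume i: "i \<in> {1..r}" and a: "a \<in> GF i"
    define c where "c = orbit_poly i a"
    have c: "c \<in> monics i" "c \<noteq> 0" unfolding c_def using a by (simp_all add: orbit_poly_monics orbit_poly_nz)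
    have "(\<Sum>g\<in>monics r. if c dvd g then lambda g else 0) = (\<Sum>g\<in>{g\<in>monics r. c dvd g}. lambda g)"
      using finite_monics[of r] by (simp add: sum.If_cases Int_def)
    also have "\<dots> = (\<Sum>g\<in>monics (r - i). lambda (c * g))"
    proof (rule sum.reindex_bij_witness[of _ "\<lambda>g. c * g" "\<lambda>g. g div c"])
      show "g div c \<in> monics (r - i)" if "g \<in> {g\<in>monics r. c dvd g}" for g
        using that monics_divide[of c "g div c" r i] c by auto
      show "c * g \<in> {g\<in>monics r. c dvd g}" if "g \<in> monics (r - i)" for g
        using monics_mult[OF c(1) that] i by simp
    qed (use c in auto)
    also have "\<dots> = lambda c * lcoeff (r - i)"
      unfolding lcoeff_def sum_distrib_left by (intro sum.cong refl lambda_mult[OF c(1)])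
    finally show "(\<Sum>g\<in>monics r. if orbit_poly i a dvd g then lambda g else 0)
        = lambda (orbit_poly i a) * lcoeff (r - i)" unfolding c_def .
  qed
  also have "\<dots> = (\<Sum>i=1..r. ssum i * lcoeff (r - i))"
    by (simp add: ssum_def sum_distrib_right lambda_orbit_poly)
  finally show ?thesis .
qed

lemma lcoeff_1: "lcoeff 1 = (\<Sum>k<p. psi (poly h (of_nat k)))"
proof -
  have "lcoeff 1 = ssum 1" using lcoeff_recurrence[of 1] by (simp add: lcoeff_0)
  also have "\<dots> = (\<Sum>a\<in>GF 1. psi (poly h a))" by (simp add: ssum_def)
  also have "\<dots> = (\<Sum>k<p. psi (poly h (of_nat k)))"
    unfolding GF_1_eq by (simp add: sum.reindex inj_on_of_nat)
  finally show ?thesis .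
qed

end

section \<open>From power sums to zeros\<close>

text \<open>With constant coefficient \<open>1\<close>, the coefficient of \<open>z\<close> is minus
  the sum of the reciprocals of the zeros, each of modulus at most \<open>w\<close>. The induction
  splits off a factor \<open>1 - X / z\<close>.\<close>

lemma norm_coeff_1_le:
  fixes L :: "complex poly"
  assumes "coeff L 0 = 1" "\<And>z. poly L z = 0 \<Longrightarrow> 1 \<le> w * norm z" "0 < w"
  shows "norm (coeff L 1) \<le> real (degree L) * w"
  using assms
proof (induction "degree L" arbitrary: L)
  case 0
  then have "coeff L 1 = 0" by (simp add: coeff_eq_0)
  then show ?case using 0 by simp
next
  case (Suc d)
  have "\<not> constant (poly L)" using Suc.hyps(2) constant_degree[of L] by simp
  then obtain z where z: "poly L z = 0" using fundamental_theorem_of_algebra by blast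
  then have z0: "z \<noteq> 0" using Suc.prems(1) by (auto simp: poly_0_coeff_0)
  obtain q where q: "L = [:- z, 1:] * q" using z by (auto simp: poly_eq_0_iff_dvd elim: dvdE)
  define q' where "q' = smult (- z) q"
  have Lq: "L = [:1, - 1 / z:] * q'" unfolding q q'_def using z0
    by (simp add: smult_add_right algebra_simps)
  have q0: "q' \<noteq> 0" using Suc.prems(1) Lq by auto
  have c0: "coeff q' 0 = 1" using Suc.prems(1) Lq by (simp add: coeff_mult)
  have dg: "degree L = Suc (degree q')" unfolding Lq using q0 z0 by (subst degree_mult_eq) auto
  have "norm (coeff q' 1) \<le> real (degree q') * w"
    by (rule Suc.hyps(1)) (use Suc dg c0 Lq in auto)
  moreover have "coeff L 1 = coeff q' 1 - 1 / z" using c0 by (simp add: Lq)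
  moreover have "norm (1 / z) \<le> w" using Suc.prems(2)[OF z] z0 by (simp add: norm_divide field_simps)
  ultimately have "norm (coeff L 1) \<le> real (degree q') * w + w"
    using norm_triangle_ineq4[of "coeff q' 1" "1 / z"] by (smt (verit))
  then show ?case using dg by (simp add: algebra_simps)
qed

text \<open>
  With \<open>L = \<Sum> l r z\<^sup>r\<close> the recurrence says \<open>z L' = L \<cdot> \<Sum> s i z\<^sup>i\<close>, so \<open>L\<close> has no zero in the disc of
  convergence of the power series: its order would drop on the left but not on the right.
\<close>
lemma norm_first_coeff_le_of_power_sums:
  fixes l s :: "nat \<Rightarrow> complex"
  assumes l0: "l 0 = 1" and l_eq_0: "\<And>r. n \<le> r \<Longrightarrow> l r = 0"
    and rec: "\<And>r. of_nat r * l r = (\<Sum>i=1..r. s i * l (r - i))"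
    and bound: "\<And>i. 1 \<le> i \<Longrightarrow> norm (s i) \<le> B * w ^ i" and w: "0 < w" and n: "0 < n"
  shows "norm (l 1) \<le> real (n - 1) * w"
proof -
  define L where "L = (\<Sum>r<n. monom (l r) r)"
  have cL: "coeff L r = l r" for r
    using l_eq_0[of r] by (cases "r < n") (auto simp: L_def coeff_sum)
  have L0: "L \<noteq> 0" using cL[of 0] l0 by auto
  have dL: "degree L \<le> n - 1" by (rule degree_le) (use cL l_eq_0 in auto)
  have polyL: "poly L z = (\<Sum>r<n. l r * z ^ r)" for z
    by (simp add: L_def poly_sum poly_monom)
  have polyL': "z * poly (pderiv L) z = (\<Sum>r<n. of_nat r * l r * z ^ r)" for z
  proof -
    have "z * poly (pderiv L) z = (\<Sum>r<n. z * poly (pderiv (monom (l r) r)) z)"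
      unfolding L_def by (simp add: higher_pderiv_sum[of 1, simplified] poly_sum sum_distrib_left)
    also have "\<dots> = (\<Sum>r<n. of_nat r * l r * z ^ r)"
      by (intro sum.cong refl) (auto simp: pderiv_monom poly_monom power_eq_if)
    finally show ?thesis .
  qed
  \<comment> \<open>The recurrence starts at \<open>i = 1\<close>, the Cauchy product at
    \<open>i = 0\<close>.\<close>
  define s' where "s' i = (if i = 0 then 0 else s i)" for i
  have B0: "0 \<le> B"
  proof -
    have "0 \<le> norm (s 1)" by simp
    also have "\<dots> \<le> B * w" using bound[of 1] by simp
    finally show ?thesis using w by (simp add: zero_le_mult_iff)
  qed
  have summ: "summable (\<lambda>i. norm (s' i * z ^ i))" if "w * norm z < 1" for z
  proof (rule summable_comparison_test')
    show "summable (\<lambda>i. B * (w * norm z) ^ i)"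
      using that w by (intro summable_mult summable_geometric) simp
    show "norm (norm (s' i * z ^ i)) \<le> B * (w * norm z) ^ i" if "i \<ge> 0" for i
    proof (cases "i = 0")
      case False
      then have "norm (s i) * norm z ^ i \<le> B * w ^ i * norm z ^ i"
        using bound[of i] by (intro mult_right_mono) auto
      then show ?thesis using False by (simp add: s'_def norm_mult norm_power power_mult_distrib mult.assoc)
    qed (use B0 in \<open>simp add: s'_def\<close>)
  qed
  define f where "f z = (\<Sum>i. s' i * z ^ i)" for z
  have eq: "z * poly (pderiv L) z = f z * poly L z" if "w * norm z < 1" for z
  proof -
    have "summable (\<lambda>r. norm (l r * z ^ r))"
      by (rule summable_finite[of "{..<n}"]) (auto simp: l_eq_0)
    then have "f z * (\<Sum>r. l r * z ^ r) = (\<Sum>k. \<Sum>i\<le>k. (s' i * z ^ i) * (l (k - i) * z ^ (k - i)))"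
      unfolding f_def by (intro Cauchy_product summ that)
    also have "(\<Sum>r. l r * z ^ r) = poly L z"
      unfolding polyL by (rule suminf_finite) (auto simp: l_eq_0)
    also have "(\<lambda>k. \<Sum>i\<le>k. (s' i * z ^ i) * (l (k - i) * z ^ (k - i))) = (\<lambda>k. of_nat k * l k * z ^ k)"
    proof
      fix k
      have "(\<Sum>i\<le>k. (s' i * z ^ i) * (l (k - i) * z ^ (k - i))) = (\<Sum>i\<le>k. s' i * l (k - i)) * z ^ k"
        unfolding sum_distrib_right
        by (intro sum.cong refl) (auto simp: power_add[symmetric] mult_ac)
      also have "(\<Sum>i\<le>k. s' i * l (k - i)) = (\<Sum>i=1..k. s i * l (k - i))"
        by (intro sum.mono_neutral_cong_right) (auto simp: s'_def)
      finally show "(\<Sum>i\<le>k. (s' i * z ^ i) * (l (k - i) * z ^ (k - i))) = of_nat k * l k * z ^ k"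
        by (simp add: rec)
    qed
    also have "(\<Sum>k. of_nat k * l k * z ^ k) = z * poly (pderiv L) z"
      unfolding polyL' by (rule suminf_finite) (auto simp: l_eq_0)
    finally show ?thesis by simp
  qed
  have "1 \<le> w * norm a" if a: "poly L a = 0" for a
  proof (rule ccontr)
    assume "\<not> 1 \<le> w * norm a"
    then have wa: "w * norm a < 1" by simp
    have a0: "a \<noteq> 0" using a cL[of 0] l0 by (auto simp: poly_0_coeff_0)
    obtain G where G: "L = [:- a, 1:] ^ order a L * G" "\<not> [:- a, 1:] dvd G"
      using order_decomp[OF L0] by blast
    have Ga: "poly G a \<noteq> 0" using G(2) by (simp add: poly_eq_0_iff_dvd)
    obtain m where m: "order a L = Suc m" using a L0 by (metis order_root not0_implies_Suc)
    \<comment> \<open>This is \<open>z L' - f L\<close> divided by \<open>(z - a) ^ m\<close>. The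
      division is legal only for \<open>z\<close> other than \<open>a\<close>, where it gives zero;
      continuity carries the zero to \<open>a\<close>, where the value is
      \<open>a (m + 1) G(a)\<close> and cannot vanish.\<close>
    define \<phi> where "\<phi> z = z * (of_nat (Suc m) * poly G z + (z - a) * poly (pderiv G) z)
      - (z - a) * poly G z * f z" for z
    have \<phi>0: "\<phi> z = 0" if "w * norm z < 1" "z \<noteq> a" for z
    proof -
      have PL: "poly L z = (z - a) ^ m * ((z - a) * poly G z)"
        using arg_cong[OF G(1), of "\<lambda>L. poly L z"] by (simp add: m poly_power algebra_simps)
      have "poly (pderiv L) z = poly (pderiv ([:- a, 1:] ^ Suc m * G)) z"
        using G(1) m by simp
      also have "\<dots> = (z - a) ^ m * (of_nat (Suc m) * poly G z + (z - a) * poly (pderiv G) z)"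
        by (simp add: pderiv_mult pderiv_power_Suc pderiv_pCons poly_power algebra_simps
              del: power_Suc mult_pCons_left) (simp add: algebra_simps)
      finally have "(z - a) ^ m * (z * (of_nat (Suc m) * poly G z + (z - a) * poly (pderiv G) z))
         = (z - a) ^ m * ((z - a) * poly G z * f z)"
        using eq[OF that(1)] PL by (simp add: mult_ac)
      then show ?thesis using that(2) by (simp add: \<phi>_def)
    qed
    have "isCont f a"
      unfolding f_def
    proof (rule isCont_powser)
      \<comment> \<open>A radius strictly between \<open>norm a\<close> and \<open>1 / w\<close>,
        where the series still converges.\<close>
      define r where "r = (norm a + 1 / w) / 2"
      have "norm a < 1 / w" using wa w by (simp add: pos_less_divide_eq mult.commute)
      then have "norm a < r" by (simp add: r_def)
      moreover have "2 * (w * r) = w * norm a + 1" using w by (simp add: r_def distrib_left)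
      then have "w * r < 1" using wa by linarith
      moreover have "0 \<le> r" using w by (simp add: r_def)
      ultimately have r: "norm a < r" "w * r < 1" "0 \<le> r" by blast+
      show "summable (\<lambda>i. s' i * of_real r ^ i)"
        by (rule summable_norm_cancel, rule summ) (use r in simp)
      show "norm a < norm (complex_of_real r)" using r by simp
    qed
    then have "isCont \<phi> a" unfolding \<phi>_def by (intro continuous_intros)
    then have "(\<phi> \<longlongrightarrow> \<phi> a) (at a)" by (simp add: isCont_def)
    moreover have "(\<phi> \<longlongrightarrow> 0) (at a)"
    proof (rule tendsto_eventually)
      have "((\<lambda>z. w * norm z) \<longlongrightarrow> w * norm a) (at a)" by (intro tendsto_intros)
      then have "eventually (\<lambda>z. w * norm z < 1) (at a)" using wa by (rule order_tendstoD)
      then show "eventually (\<lambda>z. \<phi> z = 0) (at a)"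
        using eventually_neq_at_within[of a a UNIV] by eventually_elim (use \<phi>0 in auto)
    qed
    ultimately have "\<phi> a = 0" by (rule tendsto_unique[OF at_neq_bot])
    then show False using a0 Ga by (simp add: \<phi>_def del: of_nat_Suc)
  qed
  then have "norm (coeff L 1) \<le> real (degree L) * w"
    by (intro norm_coeff_1_le) (use cL l0 w in auto)
  also have "\<dots> \<le> real (n - 1) * w" using dL w by simp
  finally show ?thesis by (simp add: cL)
qed

section \<open>Stepanov's method\<close>

text \<open>Gaussian elimination: an unknown \<open>s\<close> with nonzero coefficient in equation
  \<open>e\<close> is eliminated from the others, leaving one equation and one unknown
  fewer.\<close>

lemma homogeneous_system_solution:
  fixes v :: "'t \<Rightarrow> 'e \<Rightarrow> 'b::field"
  assumes "finite E" "finite A" "card E < card A"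
  shows "\<exists>c. (\<exists>t\<in>A. c t \<noteq> 0) \<and> (\<forall>e\<in>E. (\<Sum>t\<in>A. c t * v t e) = 0)"
  using assms
proof (induction E arbitrary: A v rule: finite_induct)
  case empty
  then have "A \<noteq> {}" by auto
  then show ?case by (intro exI[of _ "\<lambda>_. 1"]) auto
next
  case (insert e E)
  show ?case
  proof (cases "\<forall>t\<in>A. v t e = 0")
    case True
    have "card E < card A" using insert by simp
    then obtain c where "\<exists>t\<in>A. c t \<noteq> 0" "\<forall>e\<in>E. (\<Sum>t\<in>A. c t * v t e) = 0"
      using insert.IH[OF insert.prems(1), of v] by blast
    with True show ?thesis by (intro exI[of _ c]) auto
  next
    case False
    then obtain s where s: "s \<in> A" "v s e \<noteq> 0" by blast
    define w where "w t e' = v t e' - v t e / v s e * v s e'" for t e'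
    have "card E < card (A - {s})" using insert s by simp
    then have "\<exists>c. (\<exists>t\<in>A - {s}. c t \<noteq> 0) \<and> (\<forall>e'\<in>E. (\<Sum>t\<in>A - {s}. c t * w t e') = 0)"
      using insert.prems(1) by (intro insert.IH) auto
    then obtain c where c: "\<exists>t\<in>A - {s}. c t \<noteq> 0" "\<forall>e'\<in>E. (\<Sum>t\<in>A - {s}. c t * w t e') = 0"
      by blast
    define d where "d = (\<Sum>t\<in>A - {s}. c t * v t e) / v s e"
    define c' where "c' t = (if t = s then - d else c t)" for t
    have sum: "(\<Sum>t\<in>A. c' t * v t e') = (\<Sum>t\<in>A - {s}. c t * v t e') - d * v s e'" for e'
    proof -
      have "(\<Sum>t\<in>A. c' t * v t e') = c' s * v s e' + (\<Sum>t\<in>A - {s}. c' t * v t e')"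
        using s insert.prems by (simp add: sum.remove)
      also have "(\<Sum>t\<in>A - {s}. c' t * v t e') = (\<Sum>t\<in>A - {s}. c t * v t e')"
        by (intro sum.cong) (auto simp: c'_def)
      finally show ?thesis by (simp add: c'_def)
    qed
    have "(\<Sum>t\<in>A. c' t * v t e) = 0" using s by (simp add: sum d_def)
    moreover have "(\<Sum>t\<in>A. c' t * v t e') = 0" if "e' \<in> E" for e'
    proof -
      have "(\<Sum>t\<in>A - {s}. c t * w t e') = (\<Sum>t\<in>A - {s}. c t * v t e') - d * v s e'"
        unfolding w_def d_def
        by (simp add: right_diff_distrib sum_subtractf sum_divide_distrib sum_distrib_right mult.assoc)
      then show ?thesis using c(2) that sum by simp
    qed
    moreover have "\<exists>t\<in>A. c' t \<noteq> 0" using c(1) by (auto simp: c'_def)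
    ultimately show ?thesis by (intro exI[of _ c']) auto
  qed
qed

text \<open>Among the terms with nonzero coefficient, the one of largest degree has nothing to
  cancel against.\<close>

lemma sum_distinct_degrees_nonzero:
  fixes R :: "'t \<Rightarrow> 'b::field poly"
  assumes "finite A" "inj_on (\<lambda>t. degree (R t)) A" "\<And>t. t \<in> A \<Longrightarrow> R t \<noteq> 0"
    and "\<exists>t\<in>A. c t \<noteq> 0"
  shows "(\<Sum>t\<in>A. smult (c t) (R t)) \<noteq> 0"
proof -
  define B where "B = {t\<in>A. c t \<noteq> 0}"
  have fB: "finite B" "B \<noteq> {}" using assms by (auto simp: B_def)
  define m where "m = Max ((\<lambda>t. degree (R t)) ` B)"
  have "m \<in> (\<lambda>t. degree (R t)) ` B" unfolding m_def using fB by (intro Max_in) auto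
  then obtain s where s: "s \<in> B" "degree (R s) = m" by auto
  have le: "degree (R t) \<le> m" if "t \<in> B" for t unfolding m_def using that fB by auto
  have "c t * coeff (R t) m = 0" if "t \<in> A - {s}" for t
  proof (cases "t \<in> B")
    case True
    then have "degree (R t) \<noteq> m" using assms(2) that s by (auto simp: inj_on_def B_def)
    then have "degree (R t) < m" using le[OF True] by simp
    then show ?thesis by (simp add: coeff_eq_0)
  next
    case False then show ?thesis using that by (simp add: B_def)
  qed
  then have "coeff (\<Sum>t\<in>A. smult (c t) (R t)) m = c s * coeff (R s) m"
    using s assms(1) sum.neutral[of "A - {s}" "\<lambda>t. c t * coeff (R t) m"]
    by (simp add: coeff_sum sum.remove[of A s] B_def)
  also have "\<dots> \<noteq> 0" using s assms(3) by (auto simp: B_def)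
  finally show ?thesis by auto
qed

section \<open>Taylor coefficients as polynomials in the base point\<close>

text \<open>
  The weight \<open>n l\<close> is compatible with products, which keeps the Taylor coefficients of a high power of
  the trace polynomial, as polynomials in the base point \<open>x\<close>, of low degree.
\<close>
definition graded :: "nat \<Rightarrow> nat \<Rightarrow> ('b::field \<Rightarrow> 'b poly) \<Rightarrow> bool" where
  "graded n D \<Phi> \<longleftrightarrow> (\<forall>l. \<exists>u. degree u \<le> D + n * l \<and> (\<forall>x. coeff (\<Phi> x) l = poly u x))"

lemma graded_mono: "graded n D \<Phi> \<Longrightarrow> D \<le> D' \<Longrightarrow> graded n D' \<Phi>"
  unfolding graded_def by (metis (no_types, lifting) add_le_mono1 le_trans)

lemma graded_poly: "degree u \<le> D \<Longrightarrow> graded n D (\<lambda>x. [:poly u x:])"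
  unfolding graded_def
proof
  fix l
  assume "degree u \<le> D"
  then show "\<exists>v. degree v \<le> D + n * l \<and> (\<forall>x. coeff [:poly u x:] l = poly v x)"
    by (intro exI[of _ "if l = 0 then u else 0"]) (auto simp: coeff_pCons split: nat.splits)
qed

lemma graded_const: "graded n D (\<lambda>x. [:c:])"
  using graded_poly[of "[:c:]" D n] by simp

lemma graded_shift: "graded n 1 (\<lambda>x :: 'b::field. [:x, 1:])"
  unfolding graded_def
proof
  fix l :: nat
  define u :: "'b poly" where "u = (if l = 0 then [:0, 1:] else if l = 1 then 1 else 0)"
  have "degree u \<le> 1 + n * l" by (simp add: u_def)
  moreover have "coeff [:x, 1:] l = poly u x" for x
    by (auto simp: u_def coeff_pCons split: nat.splits)
  ultimately show "\<exists>u. degree u \<le> 1 + n * l \<and> (\<forall>x::'b. coeff [:x, 1:] l = poly u x)" by blast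
qed

lemma graded_add:
  assumes "graded n D \<Phi>" "graded n D \<Psi>" shows "graded n D (\<lambda>x. \<Phi> x + \<Psi> x)"
  unfolding graded_def
proof
  fix l
  obtain u v where "degree u \<le> D + n * l" "\<forall>x. coeff (\<Phi> x) l = poly u x"
    "degree v \<le> D + n * l" "\<forall>x. coeff (\<Psi> x) l = poly v x"
    using assms[unfolded graded_def, THEN spec[of _ l]] by blast
  then show "\<exists>u. degree u \<le> D + n * l \<and> (\<forall>x. coeff (\<Phi> x + \<Psi> x) l = poly u x)"
    by (intro exI[of _ "u + v"]) (auto intro: degree_add_le)
qed

lemma graded_sum:
  "(\<And>t. t \<in> A \<Longrightarrow> graded n D (\<Phi> t)) \<Longrightarrow> graded n D (\<lambda>x. \<Sum>t\<in>A. \<Phi> t x)"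
proof (induction A rule: infinite_finite_induct)
  case (insert t A)
  then show ?case using graded_add[of n D "\<Phi> t" "\<lambda>x. \<Sum>t\<in>A. \<Phi> t x"] by simp
qed (use graded_const[of n D 0] in simp_all)

lemma graded_mult:
  assumes "graded n D \<Phi>" "graded n D' \<Psi>" shows "graded n (D + D') (\<lambda>x. \<Phi> x * \<Psi> x)"
  unfolding graded_def
proof
  fix l
  obtain u where u: "\<And>l. degree (u l) \<le> D + n * l" "\<And>l x. coeff (\<Phi> x) l = poly (u l) x"
    using assms(1) unfolding graded_def by metis
  obtain v where v: "\<And>l. degree (v l) \<le> D' + n * l" "\<And>l x. coeff (\<Psi> x) l = poly (v l) x"
    using assms(2) unfolding graded_def by metis
  have "degree (u i * v (l - i)) \<le> D + D' + n * l" if "i \<le> l" for i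
  proof -
    have "degree (u i * v (l - i)) \<le> (D + n * i) + (D' + n * (l - i))"
      using degree_mult_le[of "u i" "v (l - i)"] u(1)[of i] v(1)[of "l - i"] by linarith
    also have "\<dots> = D + D' + n * (i + (l - i))" by (simp only: distrib_left add.assoc add.left_commute add.commute)
    also have "\<dots> = D + D' + n * l" using that by simp
    finally show ?thesis .
  qed
  then have "degree (\<Sum>i\<le>l. u i * v (l - i)) \<le> D + D' + n * l" by (intro degree_sum_le) auto
  moreover have "coeff (\<Phi> x * \<Psi> x) l = poly (\<Sum>i\<le>l. u i * v (l - i)) x" for x
    by (simp add: coeff_mult poly_sum u(2) v(2))
  ultimately show "\<exists>u. degree u \<le> D + D' + n * l \<and> (\<forall>x. coeff (\<Phi> x * \<Psi> x) l = poly u x)" by blast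
qed

lemma graded_power: "graded n D \<Phi> \<Longrightarrow> graded n (k * D) (\<lambda>x. \<Phi> x ^ k)"
proof (induction k)
  case 0
  show ?case using graded_const[of n 0 1] by (simp add: one_pCons)
next
  case (Suc k)
  then show ?case using graded_mult[of n D \<Phi> "k * D" "\<lambda>x. \<Phi> x ^ k"] by simp
qed

lemma pcompose_power: "pcompose (f ^ k) q = pcompose f q ^ k"
  for f :: "'b::field poly"
  by (induction k) (simp_all add: pcompose_mult pcompose_1)

lemma pcompose_eq_sum: "pcompose h q = (\<Sum>k\<le>degree h. smult (coeff h k) (q ^ k))"
  for h :: "'b::field poly"
  by (simp add: pcompose_altdef poly_altdef degree_map_poly coeff_map_poly)

text \<open>Base degree \<open>0\<close> is the point: the constant term in \<open>z\<close> is
  removed, and for \<open>l \<ge> 1\<close> the degree \<open>n\<close> is covered by the weight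
  \<open>n * l\<close>. Arbitrarily high powers then stay at base degree \<open>0\<close>.\<close>

lemma graded_taylor_tail:
  assumes "degree h \<le> n"
  shows "graded n 0 (\<lambda>x. pcompose h [:x, 1:] - [:poly h x:])"
  unfolding graded_def
proof
  fix l
  have "graded 0 n (\<lambda>x. [:coeff h k:] * [:x, 1:] ^ k)" if "k \<le> degree h" for k
    by (rule graded_mono[OF graded_mult[OF graded_const[of 0 0] graded_power[OF graded_shift]]])
       (use that assms in auto)
  then have "graded 0 n (\<lambda>x. \<Sum>k\<le>degree h. [:coeff h k:] * [:x, 1:] ^ k)"
    by (intro graded_sum) auto
  then have "graded 0 n (\<lambda>x. pcompose h [:x, 1:])"
    by (simp add: pcompose_eq_sum)
  then obtain u where u: "degree u \<le> n" "\<forall>x. coeff (pcompose h [:x, 1:]) l = poly u x"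
    unfolding graded_def by force
  show "\<exists>u. degree u \<le> 0 + n * l \<and> (\<forall>x. coeff (pcompose h [:x, 1:] - [:poly h x:]) l = poly u x)"
  proof (cases "l = 0")
    case True
    then show ?thesis
      by (intro exI[of _ 0]) (simp add: poly_0_coeff_0[symmetric] poly_pcompose)
  next
    case False
    then have "n \<le> n * l" by simp
    then have "degree u \<le> n * l" using u(1) by linarith
    then show ?thesis using u False
      by (intro exI[of _ u]) (auto simp: coeff_pCons split: nat.splits)
  qed
qed

lemma linear_power_dvd_if_monom_dvd_shift:
  fixes R :: "'b::field poly"
  assumes "monom 1 k dvd pcompose R [:x, 1:]" shows "[:- x, 1:] ^ k dvd R"
proof -
  obtain g where "pcompose R [:x, 1:] = monom 1 k * g" using assms by (auto elim: dvdE)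
  then have "pcompose (pcompose R [:x, 1:]) [:- x, 1:] = pcompose (monom 1 k) [:- x, 1:] * pcompose g [:- x, 1:]"
    by (simp add: pcompose_mult)
  moreover have "pcompose (pcompose R [:x, 1:]) [:- x, 1:] = R"
    by (simp add: pcompose_assoc[symmetric] pcompose_pCons)
  moreover have "pcompose (monom (1::'b) k) [:- x, 1:] = [:- x, 1:] ^ k"
    by (simp add: monom_altdef pcompose_pCons pcompose_power)
  ultimately have "R = [:- x, 1:] ^ k * pcompose g [:- x, 1:]" by simp
  then show ?thesis by (rule dvdI)
qed

lemma monom_dvdI:
  fixes f :: "'b::field poly"
  assumes "\<And>l. l < k \<Longrightarrow> coeff f l = 0" shows "monom 1 k dvd f"
  using assms by (simp add: monom_1_dvd_iff')

context prime_char_closure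
begin

definition trace_poly :: "nat \<Rightarrow> 'a poly \<Rightarrow> 'a poly" where
  "trace_poly i h = (\<Sum>l<i. h ^ p ^ l)"

lemma poly_trace_poly: "poly (trace_poly i h) x = (\<Sum>l<i. poly h x ^ p ^ l)"
  by (simp add: trace_poly_def poly_sum poly_power)

lemma degree_trace_poly:
  assumes "0 < degree h" "0 < i"
  shows "degree (trace_poly i h) = degree h * p ^ (i - 1)"
proof -
  define j where "j = i - 1"
  have i: "i = Suc j" using assms by (simp add: j_def)
  have h0: "h \<noteq> 0" using assms by auto
  have deg: "degree (h ^ p ^ l) = degree h * p ^ l" for l using h0 by (simp add: degree_power_eq)
  have "degree (\<Sum>l<j. h ^ p ^ l) < degree (h ^ p ^ j)"
    unfolding deg
    by (rule degree_sum_less)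
       (use assms(1) p_pos p_gt1 in \<open>auto simp: deg intro!: mult_strict_left_mono power_strict_increasing\<close>)
  then show ?thesis
    unfolding trace_poly_def i by (simp add: degree_add_eq_right deg)
qed

text \<open>As Frobenius is additive, this is \<open>T(x + z) - T(x)\<close> for the trace
  polynomial \<open>T\<close>, written so that base degree \<open>0\<close> is visible.\<close>

definition tail_sum :: "nat \<Rightarrow> 'a poly \<Rightarrow> 'a \<Rightarrow> 'a poly" where
  "tail_sum i h x = (\<Sum>l<i. (pcompose h [:x, 1:] - [:poly h x:]) ^ p ^ l)"

lemma graded_tail_sum:
  assumes "degree h \<le> n" shows "graded n 0 (tail_sum i h)"
  unfolding tail_sum_def
proof (rule graded_sum)
  show "graded n 0 (\<lambda>x. (pcompose h [:x, 1:] - [:poly h x:]) ^ p ^ l)" for l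
    using graded_power[OF graded_taylor_tail[OF assms], of "p ^ l"] by simp
qed

lemma pcompose_trace_poly:
  "pcompose (trace_poly i h) [:x, 1:] = [:poly (trace_poly i h) x:] + tail_sum i h x"
proof -
  define U where "U = pcompose h [:x, 1:] - [:poly h x:]"
  have const: "[:c:] ^ k = [:c ^ k:]" for c :: 'a and k
    by (induction k) (auto simp: one_pCons)
  have "pcompose (trace_poly i h) [:x, 1:] = (\<Sum>l<i. ([:poly h x:] + U) ^ p ^ l)"
    by (simp add: trace_poly_def pcompose_sum pcompose_power U_def)
  also have "\<dots> = (\<Sum>l<i. [:poly h x ^ p ^ l:]) + (\<Sum>l<i. U ^ p ^ l)"
    by (simp add: frob_poly_add sum.distrib const)
  also have "(\<Sum>l<i. [:poly h x ^ p ^ l:]) = [:poly (trace_poly i h) x:]"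
    unfolding poly_trace_poly by (induction i) auto
  finally show ?thesis by (simp add: tail_sum_def U_def)
qed

lemma shift_power_frob: "[:x, 1:] ^ p ^ i = [:x ^ p ^ i:] + monom 1 (p ^ i)"
  for x :: 'a
proof -
  have const: "[:c:] ^ k = [:c ^ k:]" for c :: 'a and k
    by (induction k) (auto simp: one_pCons)
  have "[:x, 1:] = [:x:] + monom 1 1" by (simp add: monom_altdef)
  then show ?thesis by (simp add: frob_poly_add const monom_power)
qed

text \<open>
  A nonzero combination \<open>R\<close> of the polynomials \<open>X\<^sup>(a+qj) T\<^sup>k\<close>, whose degrees are pairwise distinct, is
  made to vanish to order \<open>p w\<close> at all points of \<open>GF i\<close> where \<open>T\<close> takes the value \<open>b\<close>. At such a point
  \<open>x\<close>, modulo a high power of \<open>z\<close>, one has \<open>(x+z)\<^sup>q = x\<close> and \<open>T(x+z) = b + U(x,z)\<close>, so that the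
  conditions are few polynomial identities of low degree in \<open>x\<close>.
\<close>
lemma stepanov:
  fixes h :: "'a poly"
  defines "n \<equiv> degree h"
  assumes n: "0 < n" "n < p" and i: "0 < i" and w: "0 < w"
    and J: "J = 1 + n * p + w" "J\<^sup>2 \<le> p ^ (i - 1)"
  shows "w * card {x \<in> GF i. poly (trace_poly i h) x = b} \<le> p ^ (i - 1) * (J + n)"
proof -
  define Q where "Q = p ^ (i - 1)"
  define q where "q = p ^ i"
  have q: "q = p * Q" unfolding q_def Q_def using i by (cases i) auto
  have Q0: "Q > 0" unfolding Q_def using p_pos by simp
  define V where "V = p * w"
  define Z where "Z = {x \<in> GF i. poly (trace_poly i h) x = b}"
  \<comment> \<open>Exceeds every degree \<open>a + j + n * l\<close> with \<open>l < V\<close>, so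
    each of the \<open>V\<close> Taylor coefficients costs \<open>D\<close> linear
    conditions.\<close>
  define D where "D = Q + J + n * V"
  define T where "T = trace_poly i h"
  have degT: "degree T = n * Q" unfolding T_def n_def Q_def using n i by (simp add: degree_trace_poly n_def)
  have T0: "T \<noteq> 0" using degT n Q0 by auto
  define A where "A = {..<Q} \<times> {..<J} \<times> {..<p}"
  define R where "R = (\<lambda>(a, j, k). monom 1 (a + q * j) * T ^ k)"
  \<comment> \<open>What the shifted \<open>R\<close> becomes at a point of \<open>Z\<close> up to
    multiples of \<open>z ^ q\<close>. With \<open>(x + z) ^ q\<close> replaced by \<open>x\<close>,
    the exponent \<open>q * j\<close> contributes only degree \<open>j\<close> in
    \<open>x\<close>.\<close>
  define G where "G = (\<lambda>(a, j, k) x. [:x, 1:] ^ a * [:x ^ j:] * ([:b:] + tail_sum i h x) ^ k)"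
  have fA: "finite A" by (simp add: A_def)

  have degR: "degree (R (a, j, k)) = a + q * j + n * Q * k" for a j k
    using T0 by (simp add: R_def degree_mult_eq degree_monom_eq degree_power_eq degT mult.commute)
  have R0: "R t \<noteq> 0" for t using T0 by (cases t) (simp add: R_def)
  \<comment> \<open>The degree is \<open>a + Q * (p * j + n * k)\<close>. Its residue modulo
    \<open>Q\<close> gives \<open>a\<close>; the residue of the bracket modulo \<open>p\<close>
    gives \<open>k\<close>, since \<open>n\<close> is prime to \<open>p\<close>; then
    \<open>j\<close> follows.\<close>
  have inj: "inj_on (\<lambda>t. degree (R t)) A"
  proof (rule inj_onI)
    fix t t' assume tt: "t \<in> A" "t' \<in> A" "degree (R t) = degree (R t')"
    obtain a j k a' j' k' where t: "t = (a, j, k)" "t' = (a', j', k')" by (metis prod_cases3)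
    note A = tt(1,2)[unfolded t]
    from tt(3) have eq: "a + Q * (p * j + n * k) = a' + Q * (p * j' + n * k')"
      by (simp add: t degR q algebra_simps)
    have a: "a < Q" "a' < Q" and k: "k < p" "k' < p" using A by (auto simp: A_def)
    from arg_cong[OF eq, of "\<lambda>u. u mod Q"] have aa: "a = a'" using a by simp
    then have jk: "p * j + n * k = p * j' + n * k'" using eq Q0 by simp
    then have "[n * k = n * k'] (mod p)" unfolding cong_def by (metis mod_mult_self4)
    moreover have "coprime n p" using prime_p n
      by (metis coprime_commute nat_dvd_not_less prime_imp_coprime)
    ultimately have "[k = k'] (mod p)" by (simp add: cong_mult_lcancel_nat)
    then have "k = k'" using k by (simp add: cong_def)
    then show "t = t'" using aa jk p_pos by (simp add: t)
  qed

  have gr: "graded n (a + j) (G (a, j, k))" for a j k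
  proof -
    have "graded n 0 (\<lambda>x. [:b:] + tail_sum i h x)"
      by (intro graded_add graded_const graded_tail_sum) (simp add: n_def)
    from graded_power[OF this, of k] have "graded n 0 (\<lambda>x. ([:b:] + tail_sum i h x) ^ k)" by simp
    moreover have "graded n a (\<lambda>x. [:x, 1:] ^ a)" using graded_power[OF graded_shift, of n a] by simp
    moreover have "graded n j (\<lambda>x. [:x ^ j:])"
      using graded_poly[of "monom 1 j" j n] degree_monom_le[of 1 j] by (simp add: poly_monom)
    ultimately have "graded n (a + j + 0) (\<lambda>x. [:x, 1:] ^ a * [:x ^ j:] * ([:b:] + tail_sum i h x) ^ k)"
      by (intro graded_mult)
    then show ?thesis by (simp add: G_def)
  qed
  have "\<forall>t l. \<exists>u. (t \<in> A \<longrightarrow> l < V \<longrightarrow> degree u < D) \<and> (\<forall>x. coeff (G t x) l = poly u x)"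
  proof (intro allI)
    fix t :: "nat \<times> nat \<times> nat" and l
    obtain a j k where t: "t = (a, j, k)" by (cases t)
    obtain u where u: "degree u \<le> a + j + n * l" "\<forall>x. coeff (G t x) l = poly u x"
      using gr[of a j k] unfolding graded_def t by blast
    have "degree u < D" if "t \<in> A" "l < V"
    proof -
      have "n * l \<le> n * V" using that by simp
      moreover have "a < Q" "j < J" using that by (auto simp: t A_def)
      ultimately show ?thesis using u(1) unfolding D_def by linarith
    qed
    with u(2) show "\<exists>u. (t \<in> A \<longrightarrow> l < V \<longrightarrow> degree u < D) \<and> (\<forall>x. coeff (G t x) l = poly u x)" by blast
  qed
  then obtain u where u: "\<And>t l. t \<in> A \<Longrightarrow> l < V \<Longrightarrow> degree (u t l) < D"
      "\<And>t l x. coeff (G t x) l = poly (u t l) x"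
    by metis
  \<comment> \<open>There are \<open>p w (Q + J + n p w)\<close> conditions and \<open>p Q J\<close>
    unknowns. As \<open>J - w = 1 + n p\<close>, the surplus \<open>Q (J - w)\<close> is
    \<open>Q (1 + n p)\<close>, while \<open>w (J + n p w)\<close> is less than
    \<open>J^2 (1 + n p)\<close>, which \<open>J^2 \<le> Q\<close> covers.\<close>
  have "card ({..<V} \<times> {..<D}) < card A"
  proof -
    have "J * J \<le> Q" using J(2) by (simp add: power2_eq_square Q_def)
    have wJ: "w < J" using J(1) by simp
    have "w * (J + n * p * w) \<le> w * (J + n * p * J)" using wJ by simp
    also have "\<dots> < J * (J + n * p * J)"
      by (rule mult_strict_right_mono) (use wJ in auto)
    also have "\<dots> = (J * J) * (1 + n * p)" by (simp add: algebra_simps)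
    also have "\<dots> \<le> Q * (1 + n * p)" using \<open>J * J \<le> Q\<close> by (rule mult_right_mono) simp
    finally have "w * Q + w * (J + n * p * w) < w * Q + Q * (1 + n * p)" by simp
    also have "\<dots> = Q * J" unfolding J(1) by (simp add: algebra_simps)
    finally have "w * (Q + J + n * (p * w)) < Q * J" by (simp add: algebra_simps)
    then have "p * (w * (Q + J + n * (p * w))) < p * (Q * J)" using p_pos by simp
    then show ?thesis by (simp add: A_def V_def D_def card_cartesian_product algebra_simps)
  qed
  then have "\<exists>c. (\<exists>t\<in>A. c t \<noteq> 0) \<and>
      (\<forall>e\<in>{..<V} \<times> {..<D}. (\<Sum>t\<in>A. c t * (\<lambda>(l, d). coeff (u t l) d) e) = 0)"
    by (intro homogeneous_system_solution fA) auto
  then obtain c where c: "\<exists>t\<in>A. c t \<noteq> 0"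
      "\<forall>e\<in>{..<V} \<times> {..<D}. (\<Sum>t\<in>A. c t * (\<lambda>(l, d). coeff (u t l) d) e) = 0"
    by blast
  have u_sum: "(\<Sum>t\<in>A. smult (c t) (u t l)) = 0" if "l < V" for l
  proof (rule poly_eqI)
    fix d
    show "coeff (\<Sum>t\<in>A. smult (c t) (u t l)) d = coeff 0 d"
    proof (cases "d < D")
      case True
      with c(2) that have "(\<Sum>t\<in>A. c t * (\<lambda>(l, d). coeff (u t l) d) (l, d)) = 0" by blast
      then show ?thesis by (simp add: coeff_sum)
    next
      case False
      then have "coeff (u t l) d = 0" if "t \<in> A" for t
        using u(1)[OF that \<open>l < V\<close>] by (intro coeff_eq_0) linarith
      then show ?thesis by (simp add: coeff_sum)
    qed
  qed
  define F where "F = (\<Sum>t\<in>A. smult (c t) (R t))"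
  have F0: "F \<noteq> 0" unfolding F_def by (rule sum_distinct_degrees_nonzero[OF fA inj R0 c(1)])

  have dvdF: "[:- x, 1:] ^ V dvd F" if x: "x \<in> Z" for x
  proof (rule linear_power_dvd_if_monom_dvd_shift)
    \<comment> \<open>Aim: \<open>V \<le> q\<close>, so that the discarded multiples of
      \<open>z ^ q\<close> do not affect vanishing to order \<open>V\<close>.\<close>
    have "w \<le> J * J" using J(1) by (simp add: trans_le_add1)
    also have "\<dots> \<le> Q" using J(2) by (simp add: power2_eq_square Q_def)
    finally have "V \<le> q" unfolding V_def q by simp
    then have mq: "monom (1 :: 'a) V dvd monom 1 q"
      by (intro monom_dvdI) simp
    have xq: "x ^ p ^ i = x" "poly T x = b" using x by (auto simp: Z_def GF_def T_def)
    have RG: "monom 1 V dvd pcompose (R t) [:x, 1:] - G t x" for t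
    proof -
      obtain a j k where t: "t = (a, j, k)" by (cases t)
      have const: "[:x:] ^ j = [:x ^ j:]"
        by (induction j) (auto simp: one_pCons)
      have "pcompose (R t) [:x, 1:] = [:x, 1:] ^ (a + q * j) * pcompose T [:x, 1:] ^ k"
        by (simp add: t R_def pcompose_mult pcompose_power monom_altdef pcompose_pCons)
      also have "pcompose T [:x, 1:] = [:b:] + tail_sum i h x"
        using pcompose_trace_poly[of i h x] xq by (simp add: T_def)
      also have "[:x, 1:] ^ (a + q * j) = [:x, 1:] ^ a * ([:x:] + monom 1 q) ^ j"
        using shift_power_frob[of x i] xq by (simp only: power_add power_mult q_def)
      finally have "pcompose (R t) [:x, 1:] - G t x
        = (([:x:] + monom 1 q) ^ j - [:x:] ^ j) * ([:x, 1:] ^ a * ([:b:] + tail_sum i h x) ^ k)"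
        unfolding t G_def prod.case const[symmetric] by (simp add: algebra_simps)
      moreover have "([:x:] + monom 1 q) - [:x:] dvd ([:x:] + monom 1 q) ^ j - [:x:] ^ j"
        by (simp only: power_diff_sumr2 dvd_triv_left)
      then have "monom 1 V dvd ([:x:] + monom 1 q) ^ j - [:x:] ^ j"
        using mq by (metis add_diff_cancel_left' dvd_trans)
      ultimately show ?thesis by (simp add: dvd_mult2)
    qed
    have "coeff (\<Sum>t\<in>A. smult (c t) (G t x)) l = 0" if "l < V" for l
    proof -
      have "coeff (\<Sum>t\<in>A. smult (c t) (G t x)) l = poly (\<Sum>t\<in>A. smult (c t) (u t l)) x"
        by (simp add: coeff_sum u(2) poly_sum)
      then show ?thesis using u_sum[OF that] by simp
    qed
    then have "monom 1 V dvd (\<Sum>t\<in>A. smult (c t) (G t x))" by (rule monom_dvdI)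
    moreover have "monom 1 V dvd (\<Sum>t\<in>A. smult (c t) (pcompose (R t) [:x, 1:] - G t x))"
      using RG by (intro dvd_sum dvd_smult)
    ultimately have "monom 1 V dvd (\<Sum>t\<in>A. smult (c t) (pcompose (R t) [:x, 1:] - G t x))
        + (\<Sum>t\<in>A. smult (c t) (G t x))"
      by (simp add: dvd_add)
    also have "\<dots> = pcompose F [:x, 1:]"
      by (simp add: F_def pcompose_sum pcompose_smult smult_diff_right sum_subtractf)
    finally show "monom 1 V dvd pcompose F [:x, 1:]" .
  qed
  have fZ: "finite Z" unfolding Z_def using finite_GF[OF i] by simp
  have "(\<Prod>x\<in>Z. [:- x, 1:] ^ V) dvd F"
    by (rule prod_linear_power_dvd[OF fZ F0 dvdF])
  then have "degree (\<Prod>x\<in>Z. [:- x, 1:] ^ V) \<le> degree F" using F0 by (rule dvd_imp_degree_le)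
  moreover have "degree (\<Prod>x\<in>Z. [:- x, 1:] ^ V) = V * card Z"
    by (subst degree_prod_eq_sum_degree) (auto simp: degree_power_eq mult.commute)
  moreover have "degree F \<le> q * (J + n)"
    unfolding F_def
  proof (rule degree_sum_le[OF fA], goal_cases)
    case (1 t)
    obtain a j k where t: "t = (a, j, k)" by (cases t)
    have ajk: "a < Q" "j < J" "k < p" using 1 by (auto simp: t A_def)
    have "Q \<le> q" using q p_pos by simp
    have "Suc j \<le> J" using ajk by simp
    then have "q * Suc j \<le> q * J" by (rule mult_le_mono2)
    moreover have "n * Q * k \<le> n * Q * p" using ajk by simp
    moreover have "n * Q * p = q * n" by (simp add: q)
    ultimately have "a + q * j + n * Q * k \<le> q * (J + n)"
      using ajk(1) \<open>Q \<le> q\<close> unfolding mult_Suc_right distrib_left by linarith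
    then have "degree (R t) \<le> q * (J + n)" by (simp add: t degR)
    then show ?case using degree_smult_le[of "c t" "R t"] by linarith
  qed
  ultimately have "V * card Z \<le> q * (J + n)" by linarith
  then have "p * (w * card Z) \<le> p * (Q * (J + n))" by (simp add: V_def q mult.assoc)
  then show ?thesis using p_pos by (simp add: Z_def Q_def)
qed

end

section \<open>Weil's bound\<close>

context prime_char_closure
begin

text \<open>\<open>J\<close> is the largest power of \<open>p\<close> with
  \<open>J^2 \<le> p ^ (i - 1)\<close>. With \<open>w = J - c\<close>, \<open>stepanov\<close> gives
  \<open>Q + Q (c + degree h) / w\<close>, and \<open>Q / w\<close> is at most
  \<open>2 p ^ (i div 2)\<close> once \<open>w\<close> is at least half of \<open>J\<close>. Only
  small \<open>i\<close> remain, and \<open>C\<close> depends on neither \<open>i\<close> nor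
  \<open>b\<close>.\<close>

lemma card_trace_fiber_le:
  fixes h :: "'a poly"
  assumes n: "0 < degree h" "degree h < p"
  shows "\<exists>C\<ge>0. \<forall>i>0. \<forall>b. real (card {x \<in> GF i. poly (trace_poly i h) x = b})
    \<le> real p ^ (i - 1) + C * sqrt p ^ i"
proof -
  define c where "c = 1 + degree h * p"
  define C where "C = real (2 * p * c + 2 * (c + degree h))"
  have "real (card {x \<in> GF i. poly (trace_poly i h) x = b}) \<le> real p ^ (i - 1) + C * sqrt p ^ i"
    if i: "i > 0" for i b
  proof -
    define N where "N = card {x \<in> GF i. poly (trace_poly i h) x = b}"
    define J where "J = p ^ ((i - 1) div 2)"
    define Q where "Q = p ^ (i - 1)"
    have p1: "1 \<le> real p" using p_pos by simp
    have sp: "1 \<le> sqrt p" using p1 by simp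
    have sq: "sqrt p ^ (2 * k) = real p ^ k" for k by (simp add: power_mult)
    have J0: "J > 0" unfolding J_def using p_pos by simp
    have QJ: "Q \<le> p ^ (i div 2) * J"
    proof -
      have "i - 1 = i div 2 + (i - 1) div 2" using i by linarith
      then show ?thesis unfolding Q_def J_def by (metis order_refl power_add)
    qed
    have half: "real (p ^ (i div 2)) \<le> sqrt p ^ i"
    proof -
      have "real (p ^ (i div 2)) = sqrt p ^ (2 * (i div 2))" by (simp add: sq)
      also have "\<dots> \<le> sqrt p ^ i" using sp by (intro power_increasing) auto
      finally show ?thesis .
    qed
    show ?thesis
    proof (cases "J \<le> 2 * c")
      \<comment> \<open>Small \<open>i\<close>: the trivial bound \<open>p ^ i\<close> is
        \<open>sqrt p ^ i\<close> times a factor that is at most \<open>p * J\<close>, hence at most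
        \<open>2 * p * c\<close>.\<close>
      case True
      have "N \<le> p ^ i"
        unfolding N_def using card_mono[OF finite_GF[OF i], of "{x \<in> GF i. poly (trace_poly i h) x = b}"]
        by (simp add: card_GF[OF i])
      then have "real N \<le> real (p ^ i)" by (simp only: of_nat_le_iff)
      also have "real (p ^ i) = sqrt p ^ i * sqrt p ^ i" by (simp flip: power_mult_distrib)
      also have "\<dots> \<le> real (2 * p * c) * sqrt p ^ i"
      proof (rule mult_right_mono)
        have "sqrt p ^ i \<le> sqrt p ^ (2 * ((i - 1) div 2 + 1))"
        proof (rule power_increasing)
          show "i \<le> 2 * ((i - 1) div 2 + 1)" using i by presburger
        qed (rule sp)
        also have "\<dots> = real (p * J)" unfolding sq J_def by simp
        also have "\<dots> \<le> real (2 * p * c)"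
          using True by (metis mult.assoc mult.left_commute mult_le_mono2 of_nat_le_iff)
        finally show "sqrt p ^ i \<le> real (2 * p * c)" .
      qed simp
      also have "\<dots> \<le> C * sqrt p ^ i"
        unfolding C_def by (intro mult_right_mono) auto
      also have "\<dots> \<le> real p ^ (i - 1) + C * sqrt p ^ i" by simp
      finally show ?thesis by (simp add: N_def)
    next
      case False
      define w where "w = J - c"
      have w: "w > 0" "J = c + w" "J \<le> 2 * w" using False by (auto simp: w_def)
      have "J ^ 2 \<le> p ^ (i - 1)"
      proof -
        have "J ^ 2 = p ^ ((i - 1) div 2 * 2)" by (simp add: J_def power_mult)
        also have "\<dots> \<le> p ^ (i - 1)" using p_pos by (intro power_increasing) auto
        finally show ?thesis .
      qed
      then have "w * N \<le> Q * (J + degree h)"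
        unfolding N_def Q_def using w by (intro stepanov n i) (auto simp: c_def)
      also have "\<dots> = Q * w + Q * (c + degree h)" using w by (simp add: algebra_simps)
      also have "Q * (c + degree h) \<le> w * (2 * (c + degree h) * p ^ (i div 2))"
      proof -
        have "Q * (c + degree h) \<le> (p ^ (i div 2) * (2 * w)) * (c + degree h)"
          by (intro mult_right_mono order_trans[OF QJ] mult_left_mono w) auto
        then show ?thesis by (simp add: algebra_simps)
      qed
      finally have "w * N \<le> w * (Q + 2 * (c + degree h) * p ^ (i div 2))"
        by (simp add: algebra_simps)
      then have "N \<le> Q + 2 * (c + degree h) * p ^ (i div 2)" using w(1) by simp
      then have "real N \<le> real (Q + 2 * (c + degree h) * p ^ (i div 2))" by (simp only: of_nat_le_iff)
      also have "\<dots> = real Q + real (2 * (c + degree h)) * real (p ^ (i div 2))" by simp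
      also have "\<dots> \<le> real Q + C * sqrt p ^ i"
        by (intro add_left_mono mult_mono half) (auto simp: C_def)
      finally show ?thesis by (simp add: N_def Q_def)
    qed
  qed
  then show ?thesis by (intro exI[of _ C]) (auto simp: C_def)
qed

end

context additive_sum
begin

lemma sum_psi: "(\<Sum>x\<in>GF 1. psi x) = 0"
proof -
  obtain u where u: "u \<in> GF 1" "psi u \<noteq> 1" using psi_nontrivial by blast
  have "(\<Sum>x\<in>GF 1. psi x) = (\<Sum>x\<in>GF 1. psi (u + x))"
    by (rule sum.reindex_bij_witness[of _ "\<lambda>x. u + x" "\<lambda>x. x - u"]) (use u in \<open>auto intro: GF_add GF_diff\<close>)
  also have "\<dots> = psi u * (\<Sum>x\<in>GF 1. psi x)" using u by (simp add: psi_add sum_distrib_left)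
  finally show ?thesis using u(2) by simp
qed

lemma trace_in_GF_1:
  assumes "x \<in> GF i" shows "poly (trace_poly i h) x \<in> GF 1"
proof -
  define y where "y = poly h x"
  have y: "y ^ p ^ i = y" using Fr_fixed_poly[OF Fr_h, of x i] assms by (simp add: y_def GF_def)
  have "(\<Sum>l<i. y ^ p ^ l) ^ p = (\<Sum>l<i. y ^ p ^ Suc l)"
    by (simp add: frob_sum_1 power_mult[symmetric] mult.commute)
  also have "\<dots> = (\<Sum>l<i. y ^ p ^ l) + y ^ p ^ i - y ^ p ^ 0"
    using sum.lessThan_Suc_shift[of "\<lambda>l. y ^ p ^ l" i] by simp
  finally show ?thesis using y by (simp add: poly_trace_poly GF_def y_def)
qed

text \<open>Upper bounds on the fibres suffice. As \<open>psi\<close> sums to \<open>0\<close>, the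
  mean \<open>Q\<close> may be subtracted from each fibre size; the deviations sum to
  \<open>0\<close>, so the positive ones control the negative ones.\<close>

lemma norm_ssum_le: "\<exists>B. \<forall>i\<ge>1. norm (ssum i) \<le> B * sqrt p ^ i"
proof -
  obtain C where C: "C \<ge> 0" "\<And>i b. i > 0 \<Longrightarrow>
      real (card {x \<in> GF i. poly (trace_poly i h) x = b}) \<le> real p ^ (i - 1) + C * sqrt p ^ i"
    using card_trace_fiber_le[OF degree_h] by blast
  have "norm (ssum i) \<le> 2 * real p * C * sqrt p ^ i" if "i \<ge> 1" for i
  proof -
    have i: "i > 0" using that by simp
    define N where "N b = card {x \<in> GF i. poly (trace_poly i h) x = b}" for b
    define Q where "Q = real p ^ (i - 1)"
    define D where "D = C * sqrt p ^ i"
    have fin: "finite (GF i)" "finite (GF 1)" using finite_GF[OF i] finite_GF[of 1] by auto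
    have "ssum i = (\<Sum>x\<in>GF i. psi (poly (trace_poly i h) x))"
      by (simp add: ssum_def poly_trace_poly)
    also have "\<dots> = (\<Sum>b\<in>GF 1. \<Sum>x | x \<in> GF i \<and> poly (trace_poly i h) x = b. psi (poly (trace_poly i h) x))"
      by (rule sum.group[symmetric]) (use fin trace_in_GF_1 in auto)
    also have "\<dots> = (\<Sum>b\<in>GF 1. of_nat (N b) * psi b)"
      by (intro sum.cong refl) (simp add: N_def)
    also have "\<dots> = (\<Sum>b\<in>GF 1. of_real (real (N b) - Q) * psi b)"
      using sum_psi by (simp add: algebra_simps sum_subtractf flip: sum_distrib_left)
    finally have "norm (ssum i) \<le> (\<Sum>b\<in>GF 1. norm (of_real (real (N b) - Q) * psi b))"
      by (simp only: norm_sum)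
    also have "\<dots> = (\<Sum>b\<in>GF 1. \<bar>real (N b) - Q\<bar>)"
      by (intro sum.cong refl) (simp add: norm_mult norm_psi del: of_real_diff)
    \<comment> \<open>For \<open>y \<le> D\<close> and \<open>0 \<le> D\<close> one has
      \<open>\<bar>y\<bar> \<le> 2 * D - y\<close>, and the terms \<open>y\<close> cancel in the
      sum.\<close>
    also have "\<dots> \<le> (\<Sum>b\<in>GF 1. 2 * D - (real (N b) - Q))"
    proof (rule sum_mono)
      fix b
      have "real (N b) - Q \<le> D" using C(2)[OF i, of b] by (simp add: N_def Q_def D_def)
      moreover have "0 \<le> D" using C(1) by (simp add: D_def)
      ultimately show "\<bar>real (N b) - Q\<bar> \<le> 2 * D - (real (N b) - Q)" by linarith
    qed
    also have "\<dots> = 2 * real p * D - (real (\<Sum>b\<in>GF 1. N b) - real p * Q)"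
      by (simp add: sum_subtractf card_GF algebra_simps)
    also have "(\<Sum>b\<in>GF 1. N b) = card (GF i)"
      unfolding N_def using sum.group[OF fin, of "poly (trace_poly i h)" "\<lambda>_. 1::nat"] trace_in_GF_1 by auto
    also have "real (card (GF i)) = real p * Q"
      unfolding card_GF[OF i] Q_def using i by (cases i) auto
    finally show ?thesis by (simp add: D_def)
  qed
  then show ?thesis by blast
qed

theorem norm_additive_sum_le: "norm (\<Sum>k<p. psi (poly h (of_nat k))) \<le> real (degree h - 1) * sqrt p"
proof -
  obtain B where B: "\<And>i. 1 \<le> i \<Longrightarrow> norm (ssum i) \<le> B * sqrt p ^ i" using norm_ssum_le by blast
  have "norm (lcoeff 1) \<le> real (degree h - 1) * sqrt p"
    using lcoeff_0 lcoeff_eq_0 lcoeff_recurrence B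
    by (rule norm_first_coeff_le_of_power_sums) (use degree_h p_pos in auto)
  then show ?thesis unfolding lcoeff_1 .
qed

end

section \<open>Weil's bound for integer polynomials modulo \<open>p\<close>\<close>

definition e_mod :: "nat \<Rightarrow> int \<Rightarrow> complex" where
  "e_mod p a = cis (2 * pi * real_of_int a / real p)"

lemma e_mod_add: "e_mod p (a + b) = e_mod p a * e_mod p b"
  by (simp add: e_mod_def cis_mult add_divide_distrib distrib_left)

lemma e_mod_0: "e_mod p 0 = 1"
  by (simp add: e_mod_def)

lemma norm_e_mod: "norm (e_mod p a) = 1"
  by (simp add: e_mod_def)

lemma e_mod_eq_1_iff:
  assumes "p > 0" shows "e_mod p a = 1 \<longleftrightarrow> int p dvd a"
proof
  assume "e_mod p a = 1"
  then have "cos (2 * pi * real_of_int a / real p) = 1" by (simp add: e_mod_def cis.ctr complex_eq_iff)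
  then obtain n :: int where "2 * pi * real_of_int a / real p = n * 2 * pi"
    by (auto simp: cos_one_2pi_int)
  then have "real_of_int a = real_of_int n * real p" using assms by (simp add: field_simps)
  then have "a = n * int p" by (metis of_int_eq_iff of_int_mult of_int_of_nat_eq)
  then show "int p dvd a" by simp
next
  assume "int p dvd a"
  then obtain n where "a = int p * n" by auto
  then have "2 * pi * real_of_int a / real p = 2 * pi * real_of_int n" using assms by simp
  then show "e_mod p a = 1" by (simp add: e_mod_def cis_multiple_2pi)
qed

lemma e_mod_cong:
  assumes "p > 0" "[a = b] (mod int p)" shows "e_mod p a = e_mod p b"
proof -
  have "e_mod p (a - b) = 1" using assms by (simp add: e_mod_eq_1_iff cong_iff_dvd_diff)
  then show ?thesis using e_mod_add[of p "a - b" b] by simp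
qed

text \<open>Phrased with integers and free of any field type, so that it can be quantified over
  \<open>p\<close> and negated in the choice of \<open>critical_prime\<close>.\<close>

definition weil_bound :: "nat \<Rightarrow> bool" where
  "weil_bound p \<longleftrightarrow> (\<forall>h :: int poly. 0 < degree h \<and> degree h < p \<and> \<not> int p dvd lead_coeff h \<longrightarrow>
     norm (\<Sum>k<p. e_mod p (poly h (int k))) \<le> real (degree h - 1) * sqrt p)"

context prime_char_closure
begin

definition repr :: "'a \<Rightarrow> nat" where "repr = the_inv_into {..<p} of_nat"

lemma of_int_eq_iff_cong: "(of_int a :: 'a) = of_int b \<longleftrightarrow> [a = b] (mod int p)"
proof -
  have "(of_int a :: 'a) = of_int b \<longleftrightarrow> (of_int (a - b) :: 'a) = 0" by simp
  also have "\<dots> \<longleftrightarrow> int p dvd a - b" unfolding of_int_eq_0_iff_char_dvd CHAR_eq ..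
  finally show ?thesis by (simp add: cong_iff_dvd_diff)
qed

lemma of_nat_repr: "x \<in> GF 1 \<Longrightarrow> of_nat (repr x) = x"
  unfolding repr_def GF_1_eq by (rule f_the_inv_into_f[OF inj_on_of_nat])

lemma of_int_GF: "(of_int a :: 'a) \<in> GF 1"
proof -
  have "(of_int a :: 'a) = of_int (int (nat (a mod int p)))"
    using p_pos by (simp only: of_int_eq_iff_cong) (simp add: cong_def)
  also have "\<dots> \<in> GF 1" using GF_of_nat[of _ 1] by (simp only: of_int_of_nat_eq)
  finally show ?thesis .
qed

lemma e_mod_repr: "e_mod p (int (repr (of_int a :: 'a))) = e_mod p a"
proof -
  have "of_int (int (repr (of_int a :: 'a))) = (of_int a :: 'a)"
    unfolding of_int_of_nat_eq by (rule of_nat_repr[OF of_int_GF])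
  then show ?thesis using p_pos by (intro e_mod_cong) (simp_all only: of_int_eq_iff_cong)
qed

text \<open>\<open>h\<close> is reduced modulo \<open>p\<close>; its leading coefficient survives,
  hence its degree. The character of the prime field is \<open>e_mod\<close> of the representative
  given by \<open>repr\<close>.\<close>

lemma weil_bound: "weil_bound p"
  unfolding weil_bound_def
proof (intro allI impI, elim conjE)
  fix h :: "int poly"
  assume h: "0 < degree h" "degree h < p" "\<not> int p dvd lead_coeff h"
  define h' :: "'a poly" where "h' = map_poly of_int h"
  define psi :: "'a \<Rightarrow> complex" where "psi x = e_mod p (int (repr x))" for x
  have lc: "(of_int (lead_coeff h) :: 'a) \<noteq> 0"
    using h(3) CHAR_eq by (simp add: of_int_eq_0_iff_char_dvd)
  then have deg: "degree h' = degree h" unfolding h'_def by (rule map_poly_degree_eq)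
  have ch': "coeff h' k = of_int (coeff h k)" for k by (simp add: h'_def coeff_map_poly)
  have poly_h': "poly h' (of_nat k) = of_int (poly h (int k))" for k
    by (simp add: poly_altdef deg ch')
  interpret additive_sum p K psi h'
  proof
    fix x y assume xy: "x \<in> GF 1" "y \<in> GF 1"
    have "psi (x + y) = e_mod p (int (repr (of_int (int (repr x) + int (repr y)))))"
      using xy by (simp add: psi_def of_nat_repr)
    also have "\<dots> = psi x * psi y" by (simp only: e_mod_repr e_mod_add psi_def)
    finally show "psi (x + y) = psi x * psi y" .
  next
    show "norm (psi x) = 1" for x by (simp add: psi_def norm_e_mod)
  next
    have "psi (of_int 1) = e_mod p 1" unfolding psi_def by (rule e_mod_repr)
    moreover have "e_mod p 1 \<noteq> 1" using p_gt1 by (simp add: e_mod_eq_1_iff)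
    ultimately show "\<exists>x\<in>GF 1. psi x \<noteq> 1" using of_int_GF by metis
  next
    show "Fr h' = h'"
      using of_int_GF by (intro poly_eqI) (simp add: coeff_Fr ch' GF_def)
  qed (use h deg in auto)
  have "psi (poly h' (of_nat k)) = e_mod p (poly h (int k))" for k
    unfolding poly_h' psi_def by (rule e_mod_repr)
  then show "norm (\<Sum>k<p. e_mod p (poly h (int k))) \<le> real (degree h - 1) * sqrt p"
    using norm_additive_sum_le deg by simp
qed

end

text \<open>
  A type cannot depend on the variable \<open>p\<close>. So a type of cardinality \<open>critical_prime\<close> is used, a
  constant that is a counterexample to the theorem if there is any.
\<close>
definition critical_prime :: nat where
  "critical_prime = (if \<forall>p. prime p \<longrightarrow> weil_bound p then 2 else SOME p. prime p \<and> \<not> weil_bound p)"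

lemma critical_prime: "prime critical_prime"
  unfolding critical_prime_def by (simp, metis (mono_tags, lifting) someI_ex)

typedef critical_index = "{..<critical_prime}"
  using critical_prime prime_gt_0_nat by auto

lemma card_critical_index: "CARD(critical_index) = critical_prime"
  using type_definition.card[OF type_definition_critical_index] by simp

instance critical_index :: prime_card
  by standard (simp add: card_critical_index critical_prime)

text \<open>If some prime failed, \<open>critical_prime\<close> would fail; but for this one there
  is a field type of that characteristic, where the bound is proved.\<close>

theorem weil_bound_prime:
  assumes "prime p" shows "weil_bound p"
proof -
  interpret prime_char_closure critical_prime "TYPE(critical_index mod_ring alg_closure)"
    by standard (simp_all add: card_critical_index critical_prime)
  have "\<forall>p. prime p \<longrightarrow> weil_bound p"
  proof (rule ccontr)
    assume n: "\<not> (\<forall>p. prime p \<longrightarrow> weil_bound p)"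
    then have "\<exists>p. prime p \<and> \<not> weil_bound p" by blast
    from someI_ex[OF this] n have "\<not> weil_bound critical_prime"
      unfolding critical_prime_def by simp
    then show False using weil_bound by simp
  qed
  then show ?thesis using assms by blast
qed

section \<open>Exponential sums over a Sidon set\<close>

lemma cnj_e_mod: "cnj (e_mod p a) = e_mod p (- a)"
  by (simp add: e_mod_def cis_cnj)

lemma e_mod_diff: "e_mod p a * cnj (e_mod p b) = e_mod p (a - b)"
  using e_mod_add[of p a "- b"] by (simp add: cnj_e_mod)

lemma e_mod_mult: "e_mod p (int j * a) = e_mod p a ^ j"
  by (induction j) (simp_all add: e_mod_0 e_mod_add distrib_right)

lemma sum_e_mod:
  assumes "m > 0"
  shows "(\<Sum>j<m. e_mod m (int j * a)) = (if int m dvd a then of_nat m else 0)"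
proof (cases "int m dvd a")
  case True
  then have "e_mod m a = 1" using assms by (simp add: e_mod_eq_1_iff)
  then show ?thesis using True by (simp add: e_mod_mult)
next
  case False
  then have "e_mod m a \<noteq> 1" using assms by (simp add: e_mod_eq_1_iff)
  moreover have "e_mod m a ^ m = 1"
    using e_mod_eq_1_iff[OF assms, of "int m * a"] by (simp add: e_mod_mult)
  ultimately show ?thesis using False by (simp add: e_mod_mult geometric_sum)
qed

text \<open>Orthogonality of the characters modulo \<open>m\<close> leaves the pairs with congruent
  frequencies. Repetitions are allowed because the fourth moment has sums of two
  frequencies.\<close>

lemma parseval_exponential_sum:
  fixes w :: "'t \<Rightarrow> complex" and b :: "'t \<Rightarrow> int"
  assumes "m > 0" "finite I"
  shows "of_real (\<Sum>j<m. (norm (\<Sum>t\<in>I. w t * e_mod m (int j * b t)))\<^sup>2)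
    = of_nat m * (\<Sum>t\<in>I. \<Sum>t'\<in>{t'\<in>I. int m dvd b t - b t'}. w t * cnj (w t'))"
proof -
  have "of_real (\<Sum>j<m. (norm (\<Sum>t\<in>I. w t * e_mod m (int j * b t)))\<^sup>2)
      = (\<Sum>j<m. (\<Sum>t\<in>I. w t * e_mod m (int j * b t)) * cnj (\<Sum>t\<in>I. w t * e_mod m (int j * b t)))"
    by (simp only: of_real_sum complex_norm_square)
  also have "\<dots> = (\<Sum>j<m. \<Sum>t\<in>I. \<Sum>t'\<in>I. w t * cnj (w t') * e_mod m (int j * (b t - b t')))"
  proof (intro sum.cong refl)
    fix j
    have "(w t * e_mod m (int j * b t)) * cnj (w t' * e_mod m (int j * b t'))
        = w t * cnj (w t') * e_mod m (int j * (b t - b t'))" for t t'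
    proof -
      have "(w t * e_mod m (int j * b t)) * cnj (w t' * e_mod m (int j * b t'))
        = w t * cnj (w t') * (e_mod m (int j * b t) * cnj (e_mod m (int j * b t')))"
        by (simp add: mult_ac)
      then show ?thesis by (simp only: e_mod_diff right_diff_distrib)
    qed
    then show "(\<Sum>t\<in>I. w t * e_mod m (int j * b t)) * cnj (\<Sum>t\<in>I. w t * e_mod m (int j * b t))
      = (\<Sum>t\<in>I. \<Sum>t'\<in>I. w t * cnj (w t') * e_mod m (int j * (b t - b t')))"
      by (simp only: cnj_sum sum_product)
  qed
  also have "\<dots> = (\<Sum>t\<in>I. \<Sum>t'\<in>I. \<Sum>j<m. w t * cnj (w t') * e_mod m (int j * (b t - b t')))"
    by (subst sum.swap) (intro sum.cong refl sum.swap)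
  also have "\<dots> = (\<Sum>t\<in>I. \<Sum>t'\<in>I. if int m dvd b t - b t' then of_nat m * (w t * cnj (w t')) else 0)"
    by (intro sum.cong refl) (simp add: sum_e_mod[OF assms(1)] flip: sum_distrib_left)
  also have "\<dots> = of_nat m * (\<Sum>t\<in>I. \<Sum>t'\<in>{t'\<in>I. int m dvd b t - b t'}. w t * cnj (w t'))"
    unfolding sum_distrib_left
    by (rule sum.cong[OF refl], rule sum.inter_filter[OF assms(2), symmetric])
  finally show ?thesis .
qed

text \<open>
  Summing \<open>2 c\<^sup>3 u - 3 c\<^sup>2 u\<^sup>2 + u\<^sup>4 = u (u - c)\<^sup>2 (u + 2 c) \<ge> 0\<close> replaces Hoelder's inequality.
\<close>
lemma l1_lower_bound_from_moments:
  fixes y :: "'t \<Rightarrow> real"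
  assumes "\<And>t. t \<in> I \<Longrightarrow> 0 \<le> y t" "0 \<le> c"
  shows "3 * c\<^sup>2 * (\<Sum>t\<in>I. (y t)\<^sup>2) - (\<Sum>t\<in>I. (y t) ^ 4) \<le> 2 * c ^ 3 * (\<Sum>t\<in>I. y t)"
proof -
  have "3 * c\<^sup>2 * (y t)\<^sup>2 - (y t) ^ 4 \<le> 2 * c ^ 3 * y t" if "t \<in> I" for t
  proof -
    have "0 \<le> y t * (y t - c)\<^sup>2 * (y t + 2 * c)" using assms that by simp
    also have "\<dots> = 2 * c ^ 3 * y t - (3 * c\<^sup>2 * (y t)\<^sup>2 - (y t) ^ 4)"
      by (simp add: power2_eq_square power3_eq_cube power4_eq_xxxx algebra_simps)
    finally show ?thesis by simp
  qed
  then show ?thesis by (simp add: sum_distrib_left sum_mono flip: sum_subtractf)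
qed

text \<open>The Erdos-Turan construction: high digit \<open>k\<close> and low digit
  \<open>k\<^sup>2 mod p\<close> in base \<open>2 * p\<close>, where two low digits add without
  carry.\<close>

definition sidon :: "nat \<Rightarrow> nat \<Rightarrow> nat" where
  "sidon p k = 2 * p * k + k\<^sup>2 mod p"

text \<open>The difference is at most \<open>(2 p + 1) (2 p - 2)\<close> in modulus, which is below
  \<open>m\<close>, so it is zero. Both digit sums then agree, and sum and sum of squares modulo an
  odd prime determine the pair, via \<open>2 (k - k') (k - l')\<close>.\<close>

lemma sidon_mod:
  assumes p: "prime p" "3 \<le> p" and m: "m = 6 * p\<^sup>2 - 6 * p + 1"
    and k: "k < p" "l < p" "k' < p" "l' < p"
    and dvd: "int m dvd (int (sidon p k) + int (sidon p l)) - (int (sidon p k') + int (sidon p l'))"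
  shows "(k' = k \<and> l' = l) \<or> (k' = l \<and> l' = k)"
proof -
  define K where "K = int k + int l - int k' - int l'"
  define T where "T = int (k\<^sup>2 mod p) + int (l\<^sup>2 mod p) - int (k'\<^sup>2 mod p) - int (l'\<^sup>2 mod p)"
  have md: "u mod p < p" for u using p by simp
  have mi: "int m = 6 * int p * int p - 6 * int p + 1"
  proof -
    have "6 * p \<le> 6 * p\<^sup>2" by (simp add: power2_eq_square)
    then show ?thesis unfolding m by (simp add: of_nat_diff power2_eq_square)
  qed
  have KT: "(int (sidon p k) + int (sidon p l)) - (int (sidon p k') + int (sidon p l')) = 2 * int p * K + T"
    by (simp add: sidon_def K_def T_def algebra_simps)
  have K: "\<bar>K\<bar> \<le> 2 * int p - 2" using k unfolding K_def by linarith
  have T: "\<bar>T\<bar> \<le> 2 * int p - 2"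
    using md[of "k\<^sup>2"] md[of "l\<^sup>2"] md[of "k'\<^sup>2"] md[of "l'\<^sup>2"] unfolding T_def by linarith
  have "\<bar>2 * int p * K + T\<bar> \<le> 2 * int p * \<bar>K\<bar> + \<bar>T\<bar>"
    by (rule order_trans[OF abs_triangle_ineq]) (simp add: abs_mult)
  also have "\<dots> \<le> 2 * int p * (2 * int p - 2) + (2 * int p - 2)"
    using K T by (intro add_mono mult_left_mono) auto
  also have "\<dots> < int m"
  proof -
    have "4 * int p \<le> 2 * int p * int p" using p by (intro mult_right_mono) auto
    then show ?thesis unfolding mi by (simp add: algebra_simps)
  qed
  finally have "\<bar>2 * int p * K + T\<bar> < int m" .
  then have z: "2 * int p * K + T = 0"
    using dvd unfolding KT by (metis abs_of_nat dvd_imp_le_int not_less)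
  have K0: "K = 0"
  proof (rule ccontr)
    assume "K \<noteq> 0"
    then have "2 * int p * 1 \<le> 2 * int p * \<bar>K\<bar>" by (intro mult_left_mono) auto
    also have "\<dots> = \<bar>2 * int p * K\<bar>" by (simp add: abs_mult)
    also have "\<dots> = \<bar>T\<bar>" using z by linarith
    finally show False using T p by linarith
  qed
  then have T0: "T = 0" using z by simp
  have sum: "k + l = k' + l'" using K0 unfolding K_def by linarith
  have "[k\<^sup>2 + l\<^sup>2 = k'\<^sup>2 + l'\<^sup>2] (mod p)"
  proof -
    have "k\<^sup>2 mod p + l\<^sup>2 mod p = k'\<^sup>2 mod p + l'\<^sup>2 mod p" using T0 unfolding T_def by linarith
    then show ?thesis unfolding cong_def by (metis mod_add_eq)
  qed
  then have "[int k ^ 2 + int l ^ 2 = int k' ^ 2 + int l' ^ 2] (mod int p)"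
    by (metis cong_int_iff of_nat_add of_nat_power)
  then have "int p dvd (int k ^ 2 + int l ^ 2) - (int k' ^ 2 + int l' ^ 2)"
    by (simp add: cong_iff_dvd_diff)
  also have "(int k ^ 2 + int l ^ 2) - (int k' ^ 2 + int l' ^ 2) = 2 * ((int k - int k') * (int k - int l'))"
  proof -
    have l: "int l = int k' + int l' - int k" using sum by linarith
    show ?thesis unfolding l by (simp add: power2_eq_square algebra_simps)
  qed
  finally have "int p dvd 2 * ((int k - int k') * (int k - int l'))" .
  moreover have "prime (int p)" using p by simp
  moreover have "\<not> int p dvd 2" using p zdvd_imp_le[of "int p" 2] by auto
  ultimately have "int p dvd int k - int k' \<or> int p dvd int k - int l'"
    by (metis prime_dvd_multD)
  then have "k' = k \<or> k = l'"
  proof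
    assume "int p dvd int k - int k'"
    then have "[k = k'] (mod p)" by (simp add: cong_iff_dvd_diff flip: cong_int_iff)
    then show ?thesis using k by (simp add: cong_def)
  next
    assume "int p dvd int k - int l'"
    then have "[k = l'] (mod p)" by (simp add: cong_iff_dvd_diff flip: cong_int_iff)
    then show ?thesis using k by (simp add: cong_def)
  qed
  then show ?thesis using sum by auto
qed

lemma sidon_inj_mod:
  assumes p: "prime p" "3 \<le> p" and m: "m = 6 * p\<^sup>2 - 6 * p + 1" and k: "k < p" "k' < p"
    and dvd: "int m dvd int (sidon p k) - int (sidon p k')"
  shows "k' = k"
proof -
  have "int m dvd 2 * (int (sidon p k) - int (sidon p k'))" using dvd by (rule dvd_mult)
  then have "int m dvd (int (sidon p k) + int (sidon p k)) - (int (sidon p k') + int (sidon p k'))"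
    by (simp add: algebra_simps)
  from sidon_mod[OF p m k(1,1,2,2) this] show ?thesis by blast
qed

definition sidon_sum :: "nat \<Rightarrow> nat \<Rightarrow> (nat \<Rightarrow> complex) \<Rightarrow> nat \<Rightarrow> complex" where
  "sidon_sum p m c j = (\<Sum>k<p. c k * e_mod m (int j * int (sidon p k)))"

context
  fixes p m :: nat and c :: "nat \<Rightarrow> complex" and S :: real
  assumes p: "prime p" "3 \<le> p" and m: "m = 6 * p\<^sup>2 - 6 * p + 1"
    and S: "S = (\<Sum>k<p. (norm (c k))\<^sup>2)"
begin

lemma sidon_sum_second_moment: "(\<Sum>j<m. (norm (sidon_sum p m c j))\<^sup>2) = real m * S"
proof -
  have m0: "m > 0" by (simp add: m)
  have "complex_of_real (\<Sum>j<m. (norm (sidon_sum p m c j))\<^sup>2)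
    = of_nat m * (\<Sum>k\<in>{..<p}. \<Sum>k'\<in>{k'\<in>{..<p}. int m dvd int (sidon p k) - int (sidon p k')}. c k * cnj (c k'))"
    unfolding sidon_sum_def by (rule parseval_exponential_sum) (use m0 in auto)
  also have "(\<Sum>k\<in>{..<p}. \<Sum>k'\<in>{k'\<in>{..<p}. int m dvd int (sidon p k) - int (sidon p k')}. c k * cnj (c k'))
    = (\<Sum>k<p. c k * cnj (c k))"
  proof (intro sum.cong refl)
    fix k assume "k \<in> {..<p}"
    then have "{k'\<in>{..<p}. int m dvd int (sidon p k) - int (sidon p k')} = {k}"
      using sidon_inj_mod[OF p m] by auto
    then show "(\<Sum>k'\<in>{k'\<in>{..<p}. int m dvd int (sidon p k) - int (sidon p k')}. c k * cnj (c k')) = c k * cnj (c k)"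
      by simp
  qed
  also have "(\<Sum>k<p. c k * cnj (c k)) = of_real S"
    unfolding S by (simp only: of_real_sum complex_norm_square)
  finally have "complex_of_real (\<Sum>j<m. (norm (sidon_sum p m c j))\<^sup>2) = of_real (real m * S)"
    by simp
  then show ?thesis by (simp only: of_real_eq_iff)
qed

text \<open>The squared sum is an exponential sum over pairs, and a pair shares its frequency modulo
  \<open>m\<close> only with itself and its swap: this is the factor \<open>2\<close>.\<close>

lemma sidon_sum_fourth_moment: "(\<Sum>j<m. (norm (sidon_sum p m c j)) ^ 4) \<le> 2 * real m * S\<^sup>2"
proof -
  have m0: "m > 0" by (simp add: m)
  define I where "I = {..<p} \<times> {..<p}"
  define w where "w = (\<lambda>(k, l). c k * c l)"
  define b where "b = (\<lambda>(k, l). int (sidon p k) + int (sidon p l))"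
  define B where "B t = {t'\<in>I. int m dvd b t - b t'}" for t
  have fI: "finite I" by (simp add: I_def)
  have sq: "(sidon_sum p m c j)\<^sup>2 = (\<Sum>t\<in>I. w t * e_mod m (int j * b t))" for j
  proof -
    have "(sidon_sum p m c j)\<^sup>2 = (\<Sum>k<p. \<Sum>l<p. w (k, l) * e_mod m (int j * b (k, l)))"
      unfolding power2_eq_square sidon_sum_def sum_product
      by (intro sum.cong refl) (simp add: w_def b_def distrib_left e_mod_add mult_ac)
    then show ?thesis by (simp add: I_def sum.cartesian_product case_prod_unfold)
  qed
  have "(\<Sum>j<m. (norm (sidon_sum p m c j)) ^ 4) = (\<Sum>j<m. (norm (\<Sum>t\<in>I. w t * e_mod m (int j * b t)))\<^sup>2)"
    by (intro sum.cong refl) (simp add: norm_power flip: sq)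
  also have "\<dots> = norm (complex_of_real (\<Sum>j<m. (norm (\<Sum>t\<in>I. w t * e_mod m (int j * b t)))\<^sup>2))"
    unfolding norm_of_real by (intro abs_of_nonneg[symmetric] sum_nonneg) simp
  also have "\<dots> = norm (of_nat m * (\<Sum>t\<in>I. \<Sum>t'\<in>B t. w t * cnj (w t')))"
    unfolding parseval_exponential_sum[OF m0 fI] B_def ..
  also have "\<dots> = real m * norm (\<Sum>t\<in>I. \<Sum>t'\<in>B t. w t * cnj (w t'))" by (simp add: norm_mult)
  also have "\<dots> \<le> real m * (\<Sum>t\<in>I. 2 * (norm (w t))\<^sup>2)"
  proof (rule mult_left_mono, rule order_trans[OF norm_sum], rule sum_mono)
    fix t assume t: "t \<in> I"
    then obtain k l where kl: "t = (k, l)" "k < p" "l < p" by (auto simp: I_def)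
    have sub: "B t \<subseteq> {(k, l), (l, k)}"
    proof
      fix t' assume "t' \<in> B t"
      then obtain k' l' where t': "t' = (k', l')" "k' < p" "l' < p" "int m dvd b t - b t'"
        by (auto simp: B_def I_def)
      then have "(k' = k \<and> l' = l) \<or> (k' = l \<and> l' = k)"
        by (intro sidon_mod[OF p m kl(2,3)]) (auto simp: b_def kl)
      then show "t' \<in> {(k, l), (l, k)}" using t' by auto
    qed
    then have cB: "card (B t) \<le> 2"
      using card_mono[OF _ sub] card_insert_le_m1[of 2 "{(l, k)}" "(k, l)"] by simp
    have "norm (\<Sum>t'\<in>B t. w t * cnj (w t')) \<le> (\<Sum>t'\<in>B t. norm (w t * cnj (w t')))" by (rule norm_sum)
    also have "\<dots> = (\<Sum>t'\<in>B t. (norm (w t))\<^sup>2)"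
    proof (rule sum.cong[OF refl])
      fix t' assume "t' \<in> B t"
      then have "norm (w t') = norm (w t)" using sub by (auto simp: kl w_def norm_mult mult.commute)
      then show "norm (w t * cnj (w t')) = (norm (w t))\<^sup>2" by (simp add: norm_mult power2_eq_square)
    qed
    also have "\<dots> \<le> 2 * (norm (w t))\<^sup>2" using cB by (simp add: mult_right_mono)
    finally show "norm (\<Sum>t'\<in>B t. w t * cnj (w t')) \<le> 2 * (norm (w t))\<^sup>2" .
  qed simp
  also have "(\<Sum>t\<in>I. 2 * (norm (w t))\<^sup>2) = 2 * (\<Sum>k<p. \<Sum>l<p. (norm (c k))\<^sup>2 * (norm (c l))\<^sup>2)"
    unfolding I_def sum.cartesian_product sum_distrib_left
    by (intro sum.cong refl) (auto simp: w_def norm_mult power_mult_distrib)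
  also have "(\<Sum>k<p. \<Sum>l<p. (norm (c k))\<^sup>2 * (norm (c l))\<^sup>2) = S\<^sup>2"
    by (simp only: S power2_eq_square[of "sum _ _"] sum_product)
  also have "real m * (2 * S\<^sup>2) = 2 * real m * S\<^sup>2" by simp
  finally show ?thesis .
qed

lemma sidon_sum_l1_bounds:
  "real m * sqrt (S / 2) \<le> (\<Sum>j<m. norm (sidon_sum p m c j))"
  "(\<Sum>j<m. norm (sidon_sum p m c j)) \<le> real m * sqrt S"
proof -
  define L where "L = (\<Sum>j<m. norm (sidon_sum p m c j))"
  have S0: "0 \<le> S" unfolding S by (intro sum_nonneg) simp
  have L0: "0 \<le> L" unfolding L_def by (intro sum_nonneg) simp
  show "real m * sqrt (S / 2) \<le> (\<Sum>j<m. norm (sidon_sum p m c j))"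
  proof (cases "S = 0")
    case False
    define r where "r = sqrt (S / 2)"
    have r: "r > 0" "S = 2 * r\<^sup>2" using S0 False by (auto simp: r_def)
    \<comment> \<open>\<open>2 * r\<close> is \<open>sqrt (2 * S)\<close>, and \<open>2 * S\<close>
      is the ratio of the bounds for the fourth and second moments. The left side then becomes at
      least \<open>16 * m * r ^ 4\<close>.\<close>
    have "3 * (2 * r)\<^sup>2 * (\<Sum>j<m. (norm (sidon_sum p m c j))\<^sup>2) - (\<Sum>j<m. (norm (sidon_sum p m c j)) ^ 4)
        \<le> 2 * (2 * r) ^ 3 * L"
      unfolding L_def by (rule l1_lower_bound_from_moments) (use r in auto)
    then have "3 * (2 * r)\<^sup>2 * (real m * S) - 2 * real m * S\<^sup>2 \<le> 2 * (2 * r) ^ 3 * L"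
      unfolding sidon_sum_second_moment using sidon_sum_fourth_moment by linarith
    then have "(16 * r ^ 3) * (real m * r) \<le> (16 * r ^ 3) * L"
      unfolding r(2) by (simp add: power2_eq_square power3_eq_cube algebra_simps)
    then have "real m * r \<le> L" using r(1) by simp
    then show ?thesis by (simp add: L_def r_def)
  qed (use L0 L_def in simp)
  have "L \<le> L2_set (\<lambda>j. norm (sidon_sum p m c j)) {..<m} * L2_set (\<lambda>_. 1) {..<m}"
    using L2_set_mult_ineq[of "\<lambda>j. norm (sidon_sum p m c j)" "\<lambda>_. 1" "{..<m}"] by (simp add: L_def)
  also have "\<dots> = sqrt (real m * S) * sqrt (real m)"
    by (simp add: L2_set_def sidon_sum_second_moment)
  also have "\<dots> = real m * sqrt S" by (simp add: real_sqrt_mult)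
  finally show "(\<Sum>j<m. norm (sidon_sum p m c j)) \<le> real m * sqrt S" unfolding L_def .
qed

end

section \<open>Near-orthogonality on sparse vectors\<close>

lemma sum_offdiagonal_products_le:
  fixes u :: "'t \<Rightarrow> real"
  assumes "finite A"
  shows "(\<Sum>f\<in>A. \<Sum>g\<in>A - {f}. u f * u g) \<le> (real (card A) - 1) * (\<Sum>f\<in>A. (u f)\<^sup>2)"
proof (cases "A = {}")
  case False
  define W where "W = (\<Sum>f\<in>A. (u f)\<^sup>2)"
  have card: "real (card (A - {f})) = real (card A) - 1" if "f \<in> A" for f
    using that assms by (metis One_nat_def card_Suc_Diff1 diff_add_cancel of_nat_1 of_nat_Suc add.commute add_diff_cancel_left')
  have "(\<Sum>f\<in>A. \<Sum>g\<in>A - {f}. u f * u g) \<le> (\<Sum>f\<in>A. \<Sum>g\<in>A - {f}. ((u f)\<^sup>2 + (u g)\<^sup>2) / 2)"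
  proof (intro sum_mono)
    fix f g
    show "u f * u g \<le> ((u f)\<^sup>2 + (u g)\<^sup>2) / 2" using sum_squares_bound[of "u f" "u g"] by simp
  qed
  also have "\<dots> = (\<Sum>f\<in>A. ((real (card A) - 1) * (u f)\<^sup>2 + (W - (u f)\<^sup>2)) / 2)"
  proof (rule sum.cong[OF refl])
    fix f assume f: "f \<in> A"
    have "(\<Sum>g\<in>A - {f}. (u g)\<^sup>2) = W - (u f)\<^sup>2" unfolding W_def using assms f by (simp add: sum_diff1)
    then show "(\<Sum>g\<in>A - {f}. ((u f)\<^sup>2 + (u g)\<^sup>2) / 2) = ((real (card A) - 1) * (u f)\<^sup>2 + (W - (u f)\<^sup>2)) / 2"
      by (simp add: sum.distrib card[OF f] flip: sum_divide_distrib)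
  qed
  also have "\<dots> = ((real (card A) - 1) * W + (real (card A) * W - W)) / 2"
    by (simp add: sum.distrib sum_subtractf W_def sum_distrib_left flip: sum_divide_distrib)
  also have "\<dots> = (real (card A) - 1) * W" by (simp add: field_simps)
  finally show ?thesis by (simp add: W_def)
qed simp

text \<open>The diagonal of the expanded square is \<open>p\<close> times the squared norm; the rest
  enters through \<open>card A - 1\<close>, which is where sparsity acts.\<close>

lemma gram_bound:
  fixes x :: "'t \<Rightarrow> complex" and \<phi> :: "'t \<Rightarrow> nat \<Rightarrow> int"
  assumes "finite A" "0 \<le> \<delta>"
    and E: "\<And>f g. f \<in> A \<Longrightarrow> g \<in> A \<Longrightarrow> f \<noteq> g \<Longrightarrow> norm (\<Sum>k<p. e_mod p (\<phi> f k - \<phi> g k)) \<le> \<delta>"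
  shows "\<bar>(\<Sum>k<p. (norm (\<Sum>f\<in>A. x f * e_mod p (\<phi> f k)))\<^sup>2) - real p * (\<Sum>f\<in>A. (norm (x f))\<^sup>2)\<bar>
    \<le> \<delta> * ((real (card A) - 1) * (\<Sum>f\<in>A. (norm (x f))\<^sup>2))"
proof -
  define E where "E f g = (\<Sum>k<p. e_mod p (\<phi> f k - \<phi> g k))" for f g
  have diag: "complex_of_real (real p * (\<Sum>f\<in>A. (norm (x f))\<^sup>2)) = (\<Sum>f\<in>A. x f * cnj (x f) * of_nat p)"
  proof -
    have "complex_of_real (real p * (\<Sum>f\<in>A. (norm (x f))\<^sup>2))
        = of_nat p * (\<Sum>f\<in>A. complex_of_real ((norm (x f))\<^sup>2))"
      by (simp only: of_real_mult of_real_sum of_real_of_nat_eq)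
    also have "\<dots> = (\<Sum>f\<in>A. of_nat p * (x f * cnj (x f)))"
      by (simp only: complex_norm_square sum_distrib_left)
    also have "\<dots> = (\<Sum>f\<in>A. x f * cnj (x f) * of_nat p)"
      by (intro sum.cong refl mult.commute)
    finally show ?thesis .
  qed
  have Eff: "E f f = of_nat p" for f by (simp add: E_def e_mod_0)
  have "complex_of_real (\<Sum>k<p. (norm (\<Sum>f\<in>A. x f * e_mod p (\<phi> f k)))\<^sup>2)
     = (\<Sum>k<p. (\<Sum>f\<in>A. x f * e_mod p (\<phi> f k)) * cnj (\<Sum>f\<in>A. x f * e_mod p (\<phi> f k)))"
    by (simp only: of_real_sum complex_norm_square)
  also have "\<dots> = (\<Sum>k<p. \<Sum>f\<in>A. \<Sum>g\<in>A. x f * cnj (x g) * e_mod p (\<phi> f k - \<phi> g k))"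
    unfolding cnj_sum sum_product
    by (intro sum.cong refl) (simp add: mult_ac flip: e_mod_diff)
  also have "\<dots> = (\<Sum>f\<in>A. \<Sum>g\<in>A. \<Sum>k<p. x f * cnj (x g) * e_mod p (\<phi> f k - \<phi> g k))"
    by (subst sum.swap) (intro sum.cong refl sum.swap)
  also have "\<dots> = (\<Sum>f\<in>A. \<Sum>g\<in>A. x f * cnj (x g) * E f g)"
    by (simp only: E_def sum_distrib_left)
  also have "\<dots> = (\<Sum>f\<in>A. x f * cnj (x f) * of_nat p + (\<Sum>g\<in>A - {f}. x f * cnj (x g) * E f g))"
    using assms(1) by (intro sum.cong refl) (simp add: sum.remove Eff)
  also have "\<dots> = of_real (real p * (\<Sum>f\<in>A. (norm (x f))\<^sup>2)) + (\<Sum>f\<in>A. \<Sum>g\<in>A - {f}. x f * cnj (x g) * E f g)"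
    unfolding diag sum.distrib ..
  finally have "complex_of_real ((\<Sum>k<p. (norm (\<Sum>f\<in>A. x f * e_mod p (\<phi> f k)))\<^sup>2) - real p * (\<Sum>f\<in>A. (norm (x f))\<^sup>2))
    = (\<Sum>f\<in>A. \<Sum>g\<in>A - {f}. x f * cnj (x g) * E f g)"
    by (simp only: of_real_diff add_diff_cancel_left')
  from arg_cong[OF this, of norm]
  have "\<bar>(\<Sum>k<p. (norm (\<Sum>f\<in>A. x f * e_mod p (\<phi> f k)))\<^sup>2) - real p * (\<Sum>f\<in>A. (norm (x f))\<^sup>2)\<bar>
    = norm (\<Sum>f\<in>A. \<Sum>g\<in>A - {f}. x f * cnj (x g) * E f g)"
    by (simp only: norm_of_real)
  also have "\<dots> \<le> (\<Sum>f\<in>A. \<Sum>g\<in>A - {f}. \<delta> * (norm (x f) * norm (x g)))"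
  proof (intro order_trans[OF norm_sum] sum_mono)
    fix f g assume fg: "f \<in> A" "g \<in> A - {f}"
    have "norm (x f * cnj (x g) * E f g) = (norm (x f) * norm (x g)) * norm (E f g)" by (simp add: norm_mult)
    also have "\<dots> \<le> (norm (x f) * norm (x g)) * \<delta>"
      using fg E[of f g] unfolding E_def by (intro mult_left_mono) auto
    finally show "norm (x f * cnj (x g) * E f g) \<le> \<delta> * (norm (x f) * norm (x g))" by (simp add: mult.commute)
  qed
  also have "\<dots> = \<delta> * (\<Sum>f\<in>A. \<Sum>g\<in>A - {f}. norm (x f) * norm (x g))" by (simp only: sum_distrib_left)
  also have "\<dots> \<le> \<delta> * ((real (card A) - 1) * (\<Sum>f\<in>A. (norm (x f))\<^sup>2))"
    by (intro mult_left_mono sum_offdiagonal_products_le assms)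
  finally show ?thesis .
qed

section \<open>Polynomials over the prime field and the embedding\<close>

text \<open>The lists start with the leading coefficient, \<open>Poly\<close> expects the constant
  one first.\<close>

definition list_poly :: "int list \<Rightarrow> int poly" where "list_poly f = Poly (rev f)"

lemma Fp_polysD:
  assumes p: "1 < p" and f: "f \<in> Fp_polys p d"
  shows "coeffs (list_poly f) = rev f" "int (degree (list_poly f)) \<le> d"
    and "0 \<le> poly.coeff (list_poly f) i" "poly.coeff (list_poly f) i < int p" "set f \<subseteq> {0..int p - 1}"
proof -
  interpret residues "int p" "residue_ring (int p)" by unfold_locales (use p in simp_all)
  have "polynomial\<^bsub>residue_ring (int p)\<^esub> (carrier (residue_ring (int p))) f"
    using f unfolding Fp_polys_def by (simp add: univ_poly_carrier)
  then have pf: "f = [] \<or> set f \<subseteq> {0..int p - 1} \<and> hd f \<noteq> 0"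
    unfolding polynomial_def by (simp add: res_carrier_eq res_zero_eq)
  then show set: "set f \<subseteq> {0..int p - 1}" by auto
  show c: "coeffs (list_poly f) = rev f"
    using pf by (cases f) (auto simp: list_poly_def last_rev no_trailing_unfold)
  have "int (length f - 1) \<le> d" using f by (simp add: Fp_polys_def)
  then show "int (degree (list_poly f)) \<le> d" by (simp add: degree_eq_length_coeffs c)
  have "poly.coeff (list_poly f) i \<in> insert 0 (set f)"
    by (auto simp: list_poly_def coeff_Poly_eq nth_default_def) (metis length_rev nth_mem set_rev)
  then show "0 \<le> poly.coeff (list_poly f) i" "poly.coeff (list_poly f) i < int p"
    using set p by auto
qed

lemma Fp_eval_cong:
  assumes p: "1 < p" and f: "set f \<subseteq> {0..int p - 1}" and k: "k < p"
  shows "[Fp_eval p f k = poly (list_poly f) (int k)] (mod int p)"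
proof -
  interpret residues "int p" "residue_ring (int p)" by unfold_locales (use p in simp_all)
  have kk: "int k = int k mod int p" using k by simp
  have pow: "int k [^]\<^bsub>residue_ring (int p)\<^esub> n = int k ^ n mod int p" for n :: nat
    using pow_cong[of "int k" n] k by simp
  show ?thesis
    using f unfolding Fp_eval_def list_poly_def
  proof (induction f)
    case (Cons a f)
    have "poly (Poly (rev f @ [a])) (int k) = poly (Poly (rev f)) (int k) + a * int k ^ length f"
      by (simp add: Poly_snoc poly_monom)
    moreover have "ring.eval (residue_ring (int p)) (a # f) (int k)
        = (a * (int k ^ length f mod int p) mod int p + ring.eval (residue_ring (int p)) f (int k)) mod int p"
      by (simp add: res_add_eq res_mult_eq pow)
    moreover have "[(a * (int k ^ length f mod int p) mod int p + ring.eval (residue_ring (int p)) f (int k)) mod int p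
        = a * int k ^ length f + ring.eval (residue_ring (int p)) f (int k)] (mod int p)"
      by (simp add: cong_def mod_simps)
    moreover have "[a * int k ^ length f + ring.eval (residue_ring (int p)) f (int k)
        = a * int k ^ length f + poly (Poly (rev f)) (int k)] (mod int p)"
      using Cons by (intro cong_add cong_refl) auto
    ultimately show ?case by (simp add: cong_def add.commute)
  qed (simp add: res_zero_eq)
qed

text \<open>Weil's bound is applied to \<open>h = X (f - g)\<close>. The factor \<open>X\<close>,
  from the \<open>k\<close> in \<open>k f(k)\<close>, makes \<open>h\<close> nonconstant even if
  \<open>f - g\<close> is constant; the degree is at most \<open>d + 1\<close>, so Weil's factor is
  at most \<open>d\<close>. Coefficients lie in \<open>0..p - 1\<close>, hence a nonzero difference
  of two is not divisible by \<open>p\<close>.\<close>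

lemma Fp_coherence:
  assumes p: "prime p" and d: "d + 1 < int p" and f: "f \<in> Fp_polys p d" and g: "g \<in> Fp_polys p d" and ne: "f \<noteq> g"
  shows "norm (\<Sum>k<p. e_mod p (int k * Fp_eval p f k - int k * Fp_eval p g k)) \<le> real_of_int d * sqrt p"
proof -
  have p1: "1 < p" using p prime_gt_1_nat by simp
  define D where "D = list_poly f - list_poly g"
  define h where "h = pCons 0 D"
  have "rev f \<noteq> rev g" using ne by simp
  then have D0: "D \<noteq> 0" using Fp_polysD(1)[OF p1 f] Fp_polysD(1)[OF p1 g] unfolding D_def by auto
  have dD: "int (degree D) \<le> d"
    using Fp_polysD(2)[OF p1 f] Fp_polysD(2)[OF p1 g] degree_diff_le_max[of "list_poly f" "list_poly g"]
    unfolding D_def by linarith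
  have dh: "degree h = Suc (degree D)" using D0 by (simp add: h_def)
  have lc: "lead_coeff h = lead_coeff D" using D0 by (simp add: h_def)
  have "\<bar>lead_coeff D\<bar> < int p"
    using Fp_polysD(3,4)[OF p1 f, of "degree D"] Fp_polysD(3,4)[OF p1 g, of "degree D"]
    unfolding D_def coeff_diff by linarith
  moreover have "lead_coeff D \<noteq> 0" using D0 by simp
  ultimately have nd: "\<not> int p dvd lead_coeff h" unfolding lc using zdvd_not_zless[of "\<bar>lead_coeff D\<bar>" "int p"] by simp
  have "norm (\<Sum>k<p. e_mod p (poly h (int k))) \<le> real (degree h - 1) * sqrt p"
    by (rule weil_bound_prime[OF p, unfolded weil_bound_def, rule_format])
       (use nd dh dD d in linarith)
  also have "\<dots> \<le> real_of_int d * sqrt p"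
  proof (rule mult_right_mono)
    have "int (degree h - 1) \<le> d" using dD dh by simp
    then show "real (degree h - 1) \<le> real_of_int d" by linarith
  qed simp
  also have "(\<Sum>k<p. e_mod p (poly h (int k)))
      = (\<Sum>k<p. e_mod p (int k * Fp_eval p f k - int k * Fp_eval p g k))"
  proof (rule sum.cong[OF refl])
    fix k assume "k \<in> {..<p}"
    then have k: "k < p" by simp
    have "[int k * Fp_eval p f k - int k * Fp_eval p g k
        = int k * poly (list_poly f) (int k) - int k * poly (list_poly g) (int k)] (mod int p)"
      by (intro cong_diff cong_mult cong_refl Fp_eval_cong p1 k Fp_polysD(5)[OF p1 f] Fp_polysD(5)[OF p1 g])
    also have "int k * poly (list_poly f) (int k) - int k * poly (list_poly g) (int k) = poly h (int k)"
      by (simp add: h_def D_def algebra_simps)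
    finally show "e_mod p (poly h (int k)) = e_mod p (int k * Fp_eval p f k - int k * Fp_eval p g k)"
      using p1 by (intro e_mod_cong) (auto simp: cong_sym_eq)
  qed
  finally show ?thesis .
qed

lemma emb_matrix_eq:
  assumes "0 < p"
  shows "emb_matrix p m j f = 1 / of_real (sqrt p) *
    (\<Sum>k<p. e_mod p (int k * Fp_eval p f k) * e_mod m (int j * int (sidon p k)))"
proof -
  have "{0..p - 1} = {..<p}" using assms by auto
  moreover have "exp (\<i> * complex_of_real (2 * pi * (real j * (real (2 * p * k + k\<^sup>2 mod p) / real m)
         + real_of_int (int k * Fp_eval p f k) / real p)))
      = e_mod p (int k * Fp_eval p f k) * e_mod m (int j * int (sidon p k))" for k
  proof -
    have "2 * pi * (real j * (real (2 * p * k + k\<^sup>2 mod p) / real m) + real_of_int (int k * Fp_eval p f k) / real p)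
      = 2 * pi * real_of_int (int k * Fp_eval p f k) / real p + 2 * pi * real_of_int (int j * int (sidon p k)) / real m"
      by (simp add: sidon_def distrib_left add.commute mult.assoc)
    then show ?thesis by (simp only: e_mod_def cis_mult flip: cis_conv_exp)
  qed
  ultimately show ?thesis unfolding emb_matrix_def by simp
qed

lemma mat_apply_emb_matrix:
  assumes "0 < p"
  shows "mat_apply F (emb_matrix p m) x j = 1 / of_real (sqrt p) *
    sidon_sum p m (\<lambda>k. \<Sum>f\<in>F. x f * e_mod p (int k * Fp_eval p f k)) j"
proof -
  have "mat_apply F (emb_matrix p m) x j = 1 / of_real (sqrt p) *
      (\<Sum>f\<in>F. \<Sum>k<p. x f * e_mod p (int k * Fp_eval p f k) * e_mod m (int j * int (sidon p k)))"
    unfolding mat_apply_def emb_matrix_eq[OF assms] sum_distrib_left sum_distrib_right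
    by (intro sum.cong refl) (simp only: mult_ac)
  also have "(\<Sum>f\<in>F. \<Sum>k<p. x f * e_mod p (int k * Fp_eval p f k) * e_mod m (int j * int (sidon p k)))
      = (\<Sum>k<p. \<Sum>f\<in>F. x f * e_mod p (int k * Fp_eval p f k) * e_mod m (int j * int (sidon p k)))"
    by (rule sum.swap)
  finally show ?thesis by (simp only: sidon_sum_def sum_distrib_right)
qed

lemma embedding_bounds:
  assumes p: "prime p" "3 \<le> p" and m: "m = 6 * p\<^sup>2 - 6 * p + 1"
    and F: "F \<subseteq> Fp_polys p d" "finite F" and d: "0 \<le> d" "d + 1 < int p"
    and s: "1 \<le> s" "3 * real_of_int d * (real s - 1) \<le> sqrt p" and x: "sparse_on F s x"
  shows "real m / sqrt 3 * l2_norm_on F x \<le> l1_norm_on {..<m} (mat_apply F (emb_matrix p m) x)"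
    and "l1_norm_on {..<m} (mat_apply F (emb_matrix p m) x) \<le> 2 * real m / sqrt 3 * l2_norm_on F x"
proof -
  have p0: "0 < p" "0 < real p" using p by auto
  define A where "A = {f \<in> F. x f \<noteq> 0}"
  define W where "W = (\<Sum>f\<in>A. (norm (x f))\<^sup>2)"
  define c where "c k = (\<Sum>f\<in>F. x f * e_mod p (int k * Fp_eval p f k))" for k
  define S where "S = (\<Sum>k<p. (norm (c k))\<^sup>2)"
  have fA: "finite A" "card A \<le> s" "A \<subseteq> F" using F(2) x by (auto simp: A_def sparse_on_def)
  have W0: "0 \<le> W" unfolding W_def by (intro sum_nonneg) simp
  have l2: "l2_norm_on F x = sqrt W"
    unfolding l2_norm_on_def L2_set_def W_def A_def
    by (intro arg_cong[of _ _ sqrt] sum.mono_neutral_right F(2)) auto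
  have cA: "c k = (\<Sum>f\<in>A. x f * e_mod p (int k * Fp_eval p f k))" for k
    unfolding c_def A_def by (intro sum.mono_neutral_right F(2)) auto
  have "\<bar>S - real p * W\<bar> \<le> (real_of_int d * sqrt p) * ((real (card A) - 1) * W)"
    unfolding S_def cA W_def
    by (rule gram_bound) (use fA(1,3) F(1) d(1) Fp_coherence[OF p(1) d(2)] in \<open>auto simp: subset_iff\<close>)
  also have "\<dots> \<le> (real_of_int d * sqrt p) * ((real s - 1) * W)"
    using fA(2) W0 d(1) by (intro mult_left_mono mult_right_mono) auto
  also have "\<dots> = (real_of_int d * (real s - 1)) * (sqrt p * W)" by simp
  also have "\<dots> \<le> (sqrt p / 3) * (sqrt p * W)"
    using s(2) W0 by (intro mult_right_mono) auto
  also have "\<dots> = real p * W / 3" by simp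
  finally have SW: "\<bar>S - real p * W\<bar> \<le> real p * W / 3" .
  have l1: "l1_norm_on {..<m} (mat_apply F (emb_matrix p m) x) = (\<Sum>j<m. norm (sidon_sum p m c j)) / sqrt p"
    unfolding l1_norm_on_def mat_apply_emb_matrix[OF p0(1)] c_def[symmetric]
    by (simp add: norm_mult norm_divide sum_divide_distrib)
  note bounds = sidon_sum_l1_bounds[OF p m S_def]
  have SW2: "2 * (real p * W) \<le> 3 * S" "3 * S \<le> 4 * (real p * W)" using SW by linarith+
  have "W / 3 \<le> S / 2 / real p" using SW2(1) p0 by (simp add: field_simps)
  then have "sqrt (W / 3) \<le> sqrt (S / 2) / sqrt p" by (simp flip: real_sqrt_divide)
  then have "real m * sqrt (W / 3) \<le> real m * (sqrt (S / 2) / sqrt p)" by (rule mult_left_mono) simp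
  also have "\<dots> = real m * sqrt (S / 2) / sqrt p" by simp
  also have "\<dots> \<le> l1_norm_on {..<m} (mat_apply F (emb_matrix p m) x)"
    unfolding l1 by (intro divide_right_mono bounds(1)) simp
  finally show "real m / sqrt 3 * l2_norm_on F x \<le> l1_norm_on {..<m} (mat_apply F (emb_matrix p m) x)"
    by (simp add: l2 real_sqrt_divide)
  have "S / real p \<le> 4 * W / 3" using SW2(2) p0 by (simp add: field_simps)
  then have "sqrt S / sqrt p \<le> sqrt (4 * W / 3)" by (simp flip: real_sqrt_divide)
  also have "\<dots> = 2 * sqrt W / sqrt 3" by (simp add: real_sqrt_divide real_sqrt_mult)
  finally have "real m * (sqrt S / sqrt p) \<le> real m * (2 * sqrt W / sqrt 3)" by (rule mult_left_mono) simp
  moreover have "l1_norm_on {..<m} (mat_apply F (emb_matrix p m) x) \<le> real m * sqrt S / sqrt p"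
    unfolding l1 by (intro divide_right_mono bounds(2)) simp
  ultimately have "l1_norm_on {..<m} (mat_apply F (emb_matrix p m) x) \<le> real m * (2 * sqrt W / sqrt 3)"
    by simp
  then show "l1_norm_on {..<m} (mat_apply F (emb_matrix p m) x) \<le> 2 * real m / sqrt 3 * l2_norm_on F x"
    by (simp add: l2 mult_ac)
qed

text \<open>With \<open>t = s^2 ln(N)^2\<close> one has \<open>9 t \<le> p \<le> 90 t\<close>: the
  ceiling is at most \<open>5 ln(N)^2\<close> because \<open>ln N \<ge> 1/2\<close>. From
  \<open>p^2 \<le> m \<le> 6 p^2\<close> come \<open>81\<close> and \<open>48600\<close>, rounded up
  to \<open>50000\<close>.\<close>

lemma parameter_bounds:
  fixes N s p m :: nat and d :: int
  assumes s: "1 \<le> s" and p: "3 \<le> p" and N: "1 \<le> N"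
    and lo: "9 * (int s)\<^sup>2 * \<lceil>(ln (real N))\<^sup>2\<rceil> \<le> int p"
    and hi: "int p \<le> 18 * (int s)\<^sup>2 * \<lceil>(ln (real N))\<^sup>2\<rceil>"
    and m: "m = 6 * p\<^sup>2 - 6 * p + 1"
    and d: "d = \<lceil>ln (real N / real p) / ln (real p)\<rceil>"
  shows "81 * (real s ^ 4 * ln (real N) ^ 4) \<le> real m"
    and "real m \<le> 50000 * (real s ^ 4 * ln (real N) ^ 4)"
    and "3 * real_of_int d * real s \<le> sqrt p" and "d + 1 < int p"
proof -
  define l where "l = ln (real N)"
  define t where "t = real s ^ 2 * l\<^sup>2"
  \<comment> \<open>\<open>N = 1\<close> would make the logarithm zero and force
    \<open>p \<le> 0\<close>.\<close>
  have "l \<noteq> 0"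
  proof
    assume "l = 0"
    then have "int p \<le> 0" using hi by (simp add: l_def)
    then show False using p by simp
  qed
  then have N2: "2 \<le> N" using N by (cases "N = 1") (auto simp: l_def)
  then have "ln 2 \<le> l" unfolding l_def by simp
  moreover have "1/2 \<le> ln (2::real)" using ln_le_minus_one[of "1/2"] by (simp add: ln_div)
  ultimately have l: "1/2 \<le> l" by linarith
  have "(1/2)\<^sup>2 \<le> l\<^sup>2" using l by (intro power_mono) auto
  then have l2: "1/4 \<le> l\<^sup>2" by (simp add: power2_eq_square)
  have c1: "l\<^sup>2 \<le> real_of_int \<lceil>l\<^sup>2\<rceil>" by (rule le_of_int_ceiling)
  have c2: "real_of_int \<lceil>l\<^sup>2\<rceil> \<le> 5 * l\<^sup>2" using ceiling_correct[of "l\<^sup>2"] l2 by linarith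
  have t0: "0 \<le> t" by (simp add: t_def)
  have plo: "9 * t \<le> real p"
  proof -
    have "9 * t \<le> 9 * (real s)\<^sup>2 * real_of_int \<lceil>l\<^sup>2\<rceil>"
      unfolding t_def using c1 by (simp add: mult_left_mono)
    also have "\<dots> = real_of_int (9 * (int s)\<^sup>2 * \<lceil>l\<^sup>2\<rceil>)" by simp
    also have "\<dots> \<le> real p" using lo unfolding l_def by linarith
    finally show ?thesis .
  qed
  have phi: "real p \<le> 90 * t"
  proof -
    have "real p \<le> real_of_int (18 * (int s)\<^sup>2 * \<lceil>l\<^sup>2\<rceil>)" using hi unfolding l_def by linarith
    also have "\<dots> = 18 * (real s)\<^sup>2 * real_of_int \<lceil>l\<^sup>2\<rceil>" by simp
    also have "\<dots> \<le> 18 * (real s)\<^sup>2 * (5 * l\<^sup>2)" using c2 by (intro mult_left_mono) auto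
    finally show ?thesis by (simp add: t_def)
  qed
  have t2: "t\<^sup>2 = real s ^ 4 * ln (real N) ^ 4"
    by (simp add: t_def l_def power_mult_distrib flip: power_mult)
  have "6 * p \<le> 6 * p\<^sup>2" by (simp add: power2_eq_square)
  then have rm: "real m = 6 * (real p)\<^sup>2 - 6 * real p + 1" unfolding m by (simp add: of_nat_diff)
  have "(9 * t)\<^sup>2 \<le> (real p)\<^sup>2" using plo t0 by (intro power_mono) auto
  also have "(real p)\<^sup>2 \<le> real m"
  proof -
    have "3 * real p \<le> real p * real p" using p by (intro mult_right_mono) auto
    then show ?thesis unfolding rm power2_eq_square by linarith
  qed
  finally show "81 * (real s ^ 4 * ln (real N) ^ 4) \<le> real m" by (simp add: power_mult_distrib flip: t2)
  have "real m \<le> 6 * (real p)\<^sup>2" unfolding rm using p by simp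
  also have "\<dots> \<le> 6 * (90 * t)\<^sup>2" using phi by (intro mult_left_mono power_mono) auto
  also have "\<dots> \<le> 50000 * t\<^sup>2" by (simp add: power_mult_distrib)
  finally show "real m \<le> 50000 * (real s ^ 4 * ln (real N) ^ 4)" by (simp only: t2)
  have sp: "3 * (real s * l) \<le> sqrt p"
  proof (rule real_le_rsqrt)
    show "(3 * (real s * l))\<^sup>2 \<le> real p" using plo by (simp add: t_def power_mult_distrib)
  qed
  have lnp: "1 \<le> ln (real p)"
  proof -
    have "exp 1 \<le> (3::real)" by (rule exp_le)
    then have "exp 1 \<le> real p" using p by linarith
    then show ?thesis using p by (simp add: ln_ge_iff)
  qed
  have dl: "real_of_int d \<le> l"
  proof -
    \<comment> \<open>Dividing \<open>N\<close> by \<open>p\<close> subtracts exactly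
      \<open>1\<close> from the quotient of logarithms, which pays for the ceiling: \<open>d\<close>
      stays below \<open>ln N / ln p\<close>.\<close>
    have "ln (real N / real p) / ln (real p) = l / ln (real p) - 1"
      using N p lnp by (simp add: ln_div l_def diff_divide_distrib)
    then have "real_of_int d < l / ln (real p)"
      unfolding d using ceiling_correct[of "l / ln (real p) - 1"] by simp
    also have "\<dots> \<le> l" using lnp l by (simp add: divide_le_eq)
    finally show ?thesis by simp
  qed
  have "real_of_int d * real s \<le> l * real s" using dl by (rule mult_right_mono) simp
  then show "3 * real_of_int d * real s \<le> sqrt p" using sp by (simp add: mult_ac)
  have "l \<le> real s * l" using s l by simp
  moreover have "sqrt p \<le> real p"
    using p by (intro real_le_lsqrt) (auto simp: power2_eq_square)
  ultimately have "3 * real_of_int d \<le> real p" using dl sp by linarith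
  then have "3 * d \<le> int p" by linarith
  then show "d + 1 < int p" using p by linarith
qed

theorem theorem4:
  shows "\<exists>C c1 c2 :: real. 0 < C \<and> 0 < c1 \<and> 0 < c2 \<and>
    (\<forall>(N::nat) (s::nat) (p::nat) (m::nat) (d::int) (F :: int list set).
       1 \<le> N \<and> 1 \<le> s \<and> real N \<ge> C * real s ^ 4 \<and>
       prime p \<and> 3 \<le> p \<and>
       9 * (int s)\<^sup>2 * \<lceil>(ln (real N))\<^sup>2\<rceil> \<le> int p \<and>
       int p \<le> 18 * (int s)\<^sup>2 * \<lceil>(ln (real N))\<^sup>2\<rceil> \<and>
       m = 6 * p\<^sup>2 - 6 * p + 1 \<and>
       d = \<lceil>ln (real N / real p) / ln (real p)\<rceil> \<and>
       F \<subseteq> Fp_polys p d \<and> card F = N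
       \<longrightarrow>
       c1 * (real s ^ 4 * ln (real N) ^ 4) \<le> real m \<and>
       real m \<le> c2 * (real s ^ 4 * ln (real N) ^ 4) \<and>
       (\<forall>x. sparse_on F s x \<longrightarrow>
          real m / sqrt 3 * l2_norm_on F x
            \<le> l1_norm_on {..<m} (mat_apply F (emb_matrix p m) x) \<and>
          l1_norm_on {..<m} (mat_apply F (emb_matrix p m) x)
            \<le> 2 * real m / sqrt 3 * l2_norm_on F x) \<and>
       distortion_at_most m F (emb_matrix p m) s 2)"
proof (rule exI[of _ 1], rule exI[of _ 81], rule exI[of _ 50000], intro conjI allI impI; (elim conjE)?)
  fix N s p m :: nat and d :: int and F :: "int list set"
  assume N: "1 \<le> N" and s: "1 \<le> s" and p: "prime p" "3 \<le> p"
    and lo: "9 * (int s)\<^sup>2 * \<lceil>(ln (real N))\<^sup>2\<rceil> \<le> int p"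
    and hi: "int p \<le> 18 * (int s)\<^sup>2 * \<lceil>(ln (real N))\<^sup>2\<rceil>"
    and m: "m = 6 * p\<^sup>2 - 6 * p + 1"
    and d: "d = \<lceil>ln (real N / real p) / ln (real p)\<rceil>"
    and F: "F \<subseteq> Fp_polys p d" "card F = N"
  note par = parameter_bounds[OF s p(2) N lo hi m d]
  show "81 * (real s ^ 4 * ln (real N) ^ 4) \<le> real m" "real m \<le> 50000 * (real s ^ 4 * ln (real N) ^ 4)"
    by (rule par)+
  have fF: "finite F" "F \<noteq> {}" using F(2) N by (auto intro: card_ge_0_finite)
  \<comment> \<open>A member of \<open>F\<close> settles the sign of the ceiling
    \<open>d\<close>.\<close>
  then obtain f where "f \<in> Fp_polys p d" using F(1) by blast
  then have d0: "0 \<le> d" by (simp add: Fp_polys_def)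
  have "3 * real_of_int d * (real s - 1) \<le> 3 * real_of_int d * real s"
    using d0 by (intro mult_left_mono) auto
  then have sd: "3 * real_of_int d * (real s - 1) \<le> sqrt p" using par(3) by linarith
  note emb = embedding_bounds[OF p m F(1) fF(1) d0 par(4) s sd]
  show "real m / sqrt 3 * l2_norm_on F x \<le> l1_norm_on {..<m} (mat_apply F (emb_matrix p m) x)"
    "l1_norm_on {..<m} (mat_apply F (emb_matrix p m) x) \<le> 2 * real m / sqrt 3 * l2_norm_on F x"
    if "sparse_on F s x" for x
    by (rule emb[OF that])+
  have "0 < real m / sqrt 3" by (simp add: m)
  then show "distortion_at_most m F (emb_matrix p m) s 2"
    unfolding distortion_at_most_def using emb
    by (intro exI[of _ "real m / sqrt 3"] exI[of _ "2 * real m / sqrt 3"]) auto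
qed simp_all

end
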